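(* Let $(X,T,\mu,d)$ be a metric measure-preserving system with $X$ a compact Riemannian manifold, satisfying the three assumptions ($3$-fold decorrelation, Frostman property, thin annuli) listed in the context, and let $\sigma\in(0,1]$ be the constant in the $3$-fold decorrelation assumption. Let $(M_k)_{k\ge1}$ be a sequence in $[0,1]$ converging to $0$, let $r_k(x)=\inf\{r\ge0:\mu(B(x,r))\ge M_k\}$, and let $E_k=\{x\in X:T^kx\in B(x,r_k(x))\}$. Then there exist $C,\eta_1>0$ such that for all positive integers $k,l$ with $k\le\sigma l$, \[ \mu(E_k\cap E_{k+l})\le\mu(E_k)\mu(E_{k+l})+C\mu(E_{k+l})e^{-\eta_1k}+e^{-\eta_1l}. \]
   Context: A metric measure-preserving system $(X,T,\mu,d)$: $(X,d)$ is a metric space, $T\colon X\to X$ is measurable, $\mu$ is a Borel probability measure with $\mu(T^{-1}A)=\mu(A)$ for all $\mu$-measurable $A$. $B(x,r)$ is the open ball of radius $r$ around $x$. For a Lipschitz function $f$, $\|f\|_{\mathrm{Lip}}=\|f\|_\infty+[f]_1$ with $[f]_1=\sup_{x\ne y}d(f(x),f(y))/d(x,y)$. When it exists, $B(x,r_k(x))$ is the open ball around $x$ with $\mu(B(x,r_k(x)))=M_k$; under the Frostman and thin annuli assumptions the paper takes $r_k$ to be well defined on $\operatorname{supp}\mu$, hence $\mu$-a.e. Assumptions: ($3$-fold decorrelation) There exist $C,\tau>0$ and $\sigma\in(0,1]$ such that for all non-negative Lipschitz functions $\varphi_1,\varphi_2,\varphi_3\colon X\to[0,\infty)$, \[ \Bigl|\int_X\varphi_1\,(\varphi_2\circ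 T^k)\,(\varphi_3\circ T^{k+l})\,d\mu-\int_X\varphi_1\,d\mu\int_X\varphi_2\,d\mu\int_X\varphi_3\,d\mu\Bigr|\le C\|\varphi_1\|_{\mathrm{Lip}}\|\varphi_2\|_{\mathrm{Lip}}\|\varphi_3\|_{\mathrm{Lip}}\,e^{-\tau\min\{k,l\}} \] for all integers $k,l>0$, and \[ \Bigl|\int_X\varphi_1\,(\varphi_2\circ T^k)\,(\varphi_3\circ T^{k+l})\,d\mu-\int_X\varphi_1\,(\varphi_2\circ T^k)\,d\mu\int_X\varphi_3\,d\mu\Bigr|\le C\|\varphi_1\|_{\mathrm{Lip}}\|\varphi_2\|_{\mathrm{Lip}}\|\varphi_3\|_{\mathrm{Lip}}\,e^{-\tau l} \] for all integers $k,l>0$ with $k\le\sigma l$. (Frostman property) There exist $C,s>0$ such that $\mu(B(x,r))\le Cr^s$ for all $x\in X$ and all sufficiently small $r$. (Thin annuli) There exist $C,\alpha_0,r_0>0$ such that $\mu(B(x,r+\varepsilon)\setminus B(x,r))\le C\varepsilon^{\alpha_0}$ for all $0<\varepsilon\le r\le r_0$ and all $x\in X$. *)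

theory Defs
  imports "HOL-Probability.Probability"
begin

section \<open>Riemannian manifolds\<close>

text \<open>
  On an open subset of a Euclidean space, being of class C^n is defined by recursion on directional
  derivatives; in finite dimension this is the usual notion.
\<close>

primrec Cn_on ::
  "nat \<Rightarrow> 'e::euclidean_space set \<Rightarrow> ('e \<Rightarrow> 'f::real_normed_vector) \<Rightarrow> bool" where
  "Cn_on 0 S f \<longleftrightarrow> continuous_on S f"
| "Cn_on (Suc n) S f \<longleftrightarrow>
     (\<forall>u\<in>S. f differentiable (at u)) \<and>
     (\<forall>v. Cn_on n S (\<lambda>u. frechet_derivative f (at u) v))"

definition smooth_on ::
  "'e::euclidean_space set \<Rightarrow> ('e \<Rightarrow> 'f::real_normed_vector) \<Rightarrow> bool" where
  "smooth_on S f \<longleftrightarrow> (\<forall>n. Cn_on n S f)"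

text \<open>A chart \<open>(U, \<phi>)\<close>; only the values of \<open>\<phi>\<close> on \<open>U\<close> are meaningful.\<close>

type_synonym ('a, 'e) chart = "'a set \<times> ('a \<Rightarrow> 'e)"

definition chart_inv :: "('a, 'e) chart \<Rightarrow> 'e \<Rightarrow> 'a" where
  "chart_inv c = inv_into (fst c) (snd c)"

definition transition :: "('a, 'e) chart \<Rightarrow> ('a, 'e) chart \<Rightarrow> 'e \<Rightarrow> 'e" where
  "transition c c' = snd c' \<circ> chart_inv c"

text \<open>
  The metric topology of the type is the manifold topology, so the charts are homeomorphisms
  with respect to it.
\<close>

locale smooth_manifold =
  fixes atlas :: "('a::metric_space, 'e::euclidean_space) chart set"
  assumes atlas_cover: "(\<Union>c\<in>atlas. fst c) = UNIV"
    and chart_open: "\<And>c. c \<in> atlas \<Longrightarrow> open (fst c) \<and> open (snd c ` fst c)"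
    and chart_homeomorphism:
      "\<And>c. c \<in> atlas \<Longrightarrow> homeomorphism (fst c) (snd c ` fst c) (snd c) (chart_inv c)"
    and transition_smooth:
      "\<And>c c'. c \<in> atlas \<Longrightarrow> c' \<in> atlas \<Longrightarrow>
        smooth_on (snd c ` (fst c \<inter> fst c')) (transition c c')"

text \<open>
  \<open>g c p v w\<close> is the inner product at the point \<open>p\<close> of the tangent vectors whose coordinates in the
  chart \<open>c\<close> are \<open>v\<close> and \<open>w\<close>; it is meaningful only for \<open>c\<close> in the atlas and \<open>p\<close> in the domain
  of \<open>c\<close>. The last assumption says that these local expressions define one tensor field.
\<close>

locale riemannian_metric = smooth_manifold atlas
  for atlas :: "('a::metric_space, 'e::euclidean_space) chart set" +
  fixes g :: "('a, 'e) chart \<Rightarrow> 'a \<Rightarrow> 'e \<Rightarrow> 'e \<Rightarrow> real"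
  assumes g_bilinear: "\<And>c p. c \<in> atlas \<Longrightarrow> p \<in> fst c \<Longrightarrow> bilinear (g c p)"
    and g_symmetric: "\<And>c p v w. c \<in> atlas \<Longrightarrow> p \<in> fst c \<Longrightarrow> g c p v w = g c p w v"
    and g_positive: "\<And>c p v. c \<in> atlas \<Longrightarrow> p \<in> fst c \<Longrightarrow> v \<noteq> 0 \<Longrightarrow> 0 < g c p v v"
    and g_smooth:
      "\<And>c v w. c \<in> atlas \<Longrightarrow> smooth_on (snd c ` fst c) (\<lambda>u. g c (chart_inv c u) v w)"
    and g_transforms:
      "\<And>c c' p v w. c \<in> atlas \<Longrightarrow> c' \<in> atlas \<Longrightarrow> p \<in> fst c \<inter> fst c' \<Longrightarrow>
        g c p v w =
          g c' p (frechet_derivative (transition c c') (at (snd c p)) v)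
                 (frechet_derivative (transition c c') (at (snd c p)) w)"

definition C1_curve_on ::
  "('a::metric_space, 'e::euclidean_space) chart set \<Rightarrow> (real \<Rightarrow> 'a) \<Rightarrow> real set \<Rightarrow> bool" where
  "C1_curve_on atlas \<gamma> I \<longleftrightarrow> continuous_on I \<gamma> \<and>
     (\<forall>c\<in>atlas. \<exists>D.
        (\<forall>t\<in>I. \<gamma> t \<in> fst c \<longrightarrow> ((snd c \<circ> \<gamma>) has_vector_derivative D t) (at t within I)) \<and>
        continuous_on {t \<in> I. \<gamma> t \<in> fst c} D)"

definition piecewise_C1_curves ::
  "('a::metric_space, 'e::euclidean_space) chart set \<Rightarrow> 'a \<Rightarrow> 'a \<Rightarrow> (real \<Rightarrow> 'a) set" where
  "piecewise_C1_curves atlas x y = {\<gamma>. \<gamma> 0 = x \<and> \<gamma> 1 = y \<and>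
     (\<exists>(n::nat) s. s 0 = 0 \<and> s n = 1 \<and>
        (\<forall>i<n. s i < s (Suc i) \<and> C1_curve_on atlas \<gamma> {s i..s (Suc i)}))}"

text \<open>
  The speed does not depend on the chart chosen, by the transformation law of the metric. It is
  meaningful except at the finitely many break points of a piecewise C^1 curve (and the
  endpoints), which do not affect its length.
\<close>

definition curve_speed ::
  "('a::metric_space, 'e::euclidean_space) chart set \<Rightarrow> (('a, 'e) chart \<Rightarrow> 'a \<Rightarrow> 'e \<Rightarrow> 'e \<Rightarrow> real) \<Rightarrow>
    (real \<Rightarrow> 'a) \<Rightarrow> real \<Rightarrow> real" where
  "curve_speed atlas g \<gamma> t =
     (let c = (SOME c. c \<in> atlas \<and> \<gamma> t \<in> fst c);
          v = vector_derivative (snd c \<circ> \<gamma>) (at t)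
      in sqrt (g c (\<gamma> t) v v))"

definition curve_length ::
  "('a::metric_space, 'e::euclidean_space) chart set \<Rightarrow> (('a, 'e) chart \<Rightarrow> 'a \<Rightarrow> 'e \<Rightarrow> 'e \<Rightarrow> real) \<Rightarrow>
    (real \<Rightarrow> 'a) \<Rightarrow> real" where
  "curve_length atlas g \<gamma> = integral {0..1} (curve_speed atlas g \<gamma>)"

text \<open>
  Connectedness is not required: on each connected component the metric is the geodesic distance,
  and between different components, which no curve joins, any distance that leaves the metric
  compatible with the manifold topology is allowed.
\<close>

locale riemannian_manifold = riemannian_metric atlas g
  for atlas :: "('a::metric_space, 'e::euclidean_space) chart set"
    and g :: "('a, 'e) chart \<Rightarrow> 'a \<Rightarrow> 'e \<Rightarrow> 'e \<Rightarrow> real" +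
  assumes dist_geodesic:
    "\<And>x y. piecewise_C1_curves atlas x y \<noteq> {} \<Longrightarrow>
       dist x y = (INF \<gamma>\<in>piecewise_C1_curves atlas x y. curve_length atlas g \<gamma>)"

locale compact_riemannian_manifold = riemannian_manifold atlas g
  for atlas :: "('a::metric_space, 'e::euclidean_space) chart set"
    and g :: "('a, 'e) chart \<Rightarrow> 'a \<Rightarrow> 'e \<Rightarrow> 'e \<Rightarrow> real" +
  assumes compact_space: "compact (UNIV :: 'a set)"

section \<open>Metric measure-preserving systems\<close>

locale metric_mps = prob_space \<mu>
  for \<mu> :: "'a::metric_space measure" +
  fixes T :: "'a \<Rightarrow> 'a"
  assumes sets_borel: "sets \<mu> = sets borel"
    and T_measurable: "T \<in> measurable \<mu> \<mu>"
    and T_invariant: "\<And>A. A \<in> sets \<mu> \<Longrightarrow> measure \<mu> (T -` A) = measure \<mu> A"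

definition sup_norm :: "('a \<Rightarrow> real) \<Rightarrow> real" where
  "sup_norm f = (SUP x. \<bar>f x\<bar>)"

text \<open>
  The diagonal contributes \<open>0 / 0 = 0\<close> to the supremum, so it does not change the value and
  keeps the index set nonempty on a one-point space.
\<close>

definition lip_seminorm :: "('a::metric_space \<Rightarrow> real) \<Rightarrow> real" where
  "lip_seminorm f = (SUP (x, y). \<bar>f x - f y\<bar> / dist x y)"

definition lip_norm :: "('a::metric_space \<Rightarrow> real) \<Rightarrow> real" where
  "lip_norm f = sup_norm f + lip_seminorm f"

definition nonneg_lipschitz :: "('a::metric_space \<Rightarrow> real) \<Rightarrow> bool" where
  "nonneg_lipschitz f \<longleftrightarrow> (\<forall>x. 0 \<le> f x) \<and> (\<exists>L. L-lipschitz_on UNIV f)"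

definition threefold_decorrelation ::
  "'a::metric_space measure \<Rightarrow> ('a \<Rightarrow> 'a) \<Rightarrow> real \<Rightarrow> bool" where
  "threefold_decorrelation \<mu> T \<sigma> \<longleftrightarrow> 0 < \<sigma> \<and> \<sigma> \<le> 1 \<and>
     (\<exists>C>0. \<exists>\<tau>>0. \<forall>\<phi>1 \<phi>2 \<phi>3.
        nonneg_lipschitz \<phi>1 \<longrightarrow> nonneg_lipschitz \<phi>2 \<longrightarrow> nonneg_lipschitz \<phi>3 \<longrightarrow>
        (\<forall>k>0. \<forall>l>0.
           \<bar>(\<integral>x. \<phi>1 x * \<phi>2 ((T ^^ k) x) * \<phi>3 ((T ^^ (k + l)) x) \<partial>\<mu>)
             - (\<integral>x. \<phi>1 x \<partial>\<mu>) * (\<integral>x. \<phi>2 x \<partial>\<mu>) * (\<integral>x. \<phi>3 x \<partial>\<mu>)\<bar>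
           \<le> C * lip_norm \<phi>1 * lip_norm \<phi>2 * lip_norm \<phi>3 * exp (- \<tau> * real (min k l))) \<and>
        (\<forall>k>0. \<forall>l>0. real k \<le> \<sigma> * real l \<longrightarrow>
           \<bar>(\<integral>x. \<phi>1 x * \<phi>2 ((T ^^ k) x) * \<phi>3 ((T ^^ (k + l)) x) \<partial>\<mu>)
             - (\<integral>x. \<phi>1 x * \<phi>2 ((T ^^ k) x) \<partial>\<mu>) * (\<integral>x. \<phi>3 x \<partial>\<mu>)\<bar>
           \<le> C * lip_norm \<phi>1 * lip_norm \<phi>2 * lip_norm \<phi>3 * exp (- \<tau> * real l)))"

definition frostman :: "'a::metric_space measure \<Rightarrow> bool" where
  "frostman \<mu> \<longleftrightarrow>
     (\<exists>C>0. \<exists>s>0. \<forall>\<^sub>F r in at_right 0. \<forall>x. measure \<mu> (ball x r) \<le> C * r powr s)"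

definition thin_annuli :: "'a::metric_space measure \<Rightarrow> bool" where
  "thin_annuli \<mu> \<longleftrightarrow>
     (\<exists>C>0. \<exists>\<alpha>>0. \<exists>r0>0. \<forall>\<epsilon> r x. 0 < \<epsilon> \<longrightarrow> \<epsilon> \<le> r \<longrightarrow> r \<le> r0 \<longrightarrow>
        measure \<mu> (ball x (r + \<epsilon>) - ball x r) \<le> C * \<epsilon> powr \<alpha>)"

section \<open>Recurrence sets\<close>

definition mass_radius :: "'a::metric_space measure \<Rightarrow> real \<Rightarrow> 'a \<Rightarrow> real" where
  "mass_radius \<mu> m x = Inf {r. 0 \<le> r \<and> m \<le> measure \<mu> (ball x r)}"

definition recurrence_set ::
  "'a::metric_space measure \<Rightarrow> ('a \<Rightarrow> 'a) \<Rightarrow> (nat \<Rightarrow> real) \<Rightarrow> nat \<Rightarrow> 'a set" where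
  "recurrence_set \<mu> T M k = {x. (T ^^ k) x \<in> ball x (mass_radius \<mu> (M k) x)}"

end

theory Submission
  imports Defs
begin

text \<open>
  Write \<open>r\<^sub>k\<close> for the radius function, \<open>E\<^sub>k\<close> for the recurrence set, and \<open>E\<^sub>k(\<delta>)\<close> for the set of
  points with \<open>dist x (T\<^sup>k x) < r\<^sub>k x + \<delta>\<close>. The condition defining \<open>E\<^sub>k\<close> couples \<open>x\<close> and \<open>T\<^sup>k x\<close>,
  whereas decorrelation only speaks of products of functions of \<open>x\<close> and of \<open>T\<^sup>k x\<close>. Since \<open>r\<^sub>k\<close> is
  1-Lipschitz, the coupling disappears at a small scale \<open>\<rho>\<close>: for \<open>x\<close> within \<open>2\<rho>\<close> of \<open>y\<close>, membership of
  \<open>T\<^sup>k x\<close> in the ball of radius \<open>r\<^sub>k x\<close> about \<open>x\<close> is the same, up to an error \<open>O(\<rho>)\<close> in the radius, as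
  membership in the ball of radius \<open>r\<^sub>k y\<close> about \<open>y\<close>. So the indicator of \<open>E\<^sub>k\<close> is squeezed between sums
  over a Lipschitz partition of unity of scale \<open>\<rho>\<close>, each summand being a product to which decorrelation
  applies. The total error is the number of cells times a power of \<open>1/\<rho>\<close> times \<open>exp (- \<tau> k)\<close>.

  The manifold structure enters only through the number of cells, which is polynomial in \<open>1/\<rho>\<close>:
  inverse charts are locally Lipschitz, because the image of a straight segment is a competitor in the
  definition of the geodesic distance (\<open>chart_inv_locally_lipschitz\<close>, \<open>polynomially_coverable_UNIV\<close>).
  The Frostman and thin annuli conditions together say that, for small radii, the mass of a ball is a Hoelder
  continuous function of its radius, including at radius \<open>0\<close> (\<open>ball_mass_modulus\<close>). Hence changing a radius by
  \<open>O(\<rho>)\<close> changes masses by \<open>O(\<rho>\<^sup>\<beta>)\<close>, and the choice \<open>\<rho> = exp (- \<gamma> k)\<close> with small \<open>\<gamma>\<close> makes all the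
  errors exponentially small.

  Twofold decorrelation at the scale of \<open>k\<close> gives \<open>\<mu> E\<^sub>k \<ge> M\<^sub>k - O(exp (- \<eta> k))\<close>
  (\<open>return_mass_lower\<close>) and \<open>\<mu> (E\<^sub>k(\<delta>)) \<le> M\<^sub>k + O(exp (- \<eta> k))\<close> for \<open>\<delta> = O(\<rho>)\<close>
  (\<open>return_mass_upper\<close>). Threefold decorrelation at the finer scale of \<open>l\<close>, in the form that splits
  off the last factor, bounds \<open>\<mu> (E\<^sub>k \<inter> E\<^sub>k\<^sub>+\<^sub>l)\<close> by
  \<open>\<mu> (E\<^sub>k(9 \<rho>)) * (M\<^sub>k\<^sub>+\<^sub>l + O(exp (- \<eta> l))) + O(exp (- \<eta> l))\<close> (\<open>joint_return_mass\<close>).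
  Inserting the first two estimates replaces both factors by \<open>\<mu> E\<^sub>k\<close> and \<open>\<mu> E\<^sub>k\<^sub>+\<^sub>l\<close> up to the admissible
  errors. The asymptotic estimates hold for large \<open>k\<close> (then \<open>l \<ge> k\<close> is large too, and the constant in
  front of \<open>exp (- \<eta> l)\<close> is absorbed by halving \<open>\<eta>\<close>); for the finitely many remaining \<open>k\<close> the trivial
  bound by \<open>\<mu> E\<^sub>k\<^sub>+\<^sub>l\<close> is of the required form.
\<close>

section \<open>Lipschitz charts and covering numbers of a compact Riemannian manifold\<close>

lemma segment_point_in_closed_segment:
  fixes u v :: "'e::real_vector"
  assumes "t \<in> {0..1::real}"
  shows "u + t *\<^sub>R (v - u) \<in> closed_segment u v"
  unfolding closed_segment_def using assms
  by (auto intro!: exI[of _ t] simp: algebra_simps)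

lemma (in smooth_manifold) chart_inv_point:
  assumes "c \<in> atlas" "u \<in> snd c ` fst c"
  shows "chart_inv c u \<in> fst c" "snd c (chart_inv c u) = u"
  using chart_homeomorphism[OF assms(1)] assms(2) unfolding homeomorphism_def by auto

text \<open>
  In a chart \<open>c\<close> the curve is a segment of constant velocity \<open>v - u\<close>; in another chart its velocity
  is the image of \<open>v - u\<close> under the derivative of the transition map, which is the rule under which
  the Riemannian metric is invariant.
\<close>

lemma (in smooth_manifold) segment_in_chart:
  assumes c: "c \<in> atlas" and sub: "closed_segment u v \<subseteq> snd c ` fst c"
    and c': "c' \<in> atlas" and t: "t \<in> {0..1}"
    and in_c': "chart_inv c (u + t *\<^sub>R (v - u)) \<in> fst c'"
  shows "((snd c' \<circ> (\<lambda>t. chart_inv c (u + t *\<^sub>R (v - u)))) has_vector_derivative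
           frechet_derivative (transition c c') (at (u + t *\<^sub>R (v - u))) (v - u)) (at t within {0..1})"
    and "u + t *\<^sub>R (v - u) \<in> snd c ` (fst c \<inter> fst c')"
proof -
  define w where "w = u + t *\<^sub>R (v - u)"
  have "w \<in> closed_segment u v"
    unfolding w_def by (rule segment_point_in_closed_segment[OF t])
  then have wc: "w \<in> snd c ` fst c" using sub by auto
  have "chart_inv c w \<in> fst c \<inter> fst c'" "snd c (chart_inv c w) = w"
    using chart_inv_point[OF c wc] in_c' by (auto simp: w_def)
  then show w: "u + t *\<^sub>R (v - u) \<in> snd c ` (fst c \<inter> fst c')" unfolding w_def by (metis image_eqI)
  have "Cn_on (Suc 0) (snd c ` (fst c \<inter> fst c')) (transition c c')"
    using transition_smooth[OF c c'] unfolding smooth_on_def by blast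
  then have "transition c c' differentiable (at w)"
    using w unfolding w_def Cn_on.simps by blast
  then have d: "(transition c c' has_derivative frechet_derivative (transition c c') (at w)) (at w)"
    by (simp add: frechet_derivative_works)
  have l: "((\<lambda>t. u + t *\<^sub>R (v - u)) has_vector_derivative (v - u)) (at t within {0..1})"
    by (auto intro!: derivative_eq_intros)
  have "(transition c c' \<circ> (\<lambda>t. u + t *\<^sub>R (v - u)) has_vector_derivative
           frechet_derivative (transition c c') (at w) (v - u)) (at t within {0..1})"
    by (rule vector_derivative_diff_chain_within[OF l]) (use d in \<open>auto simp: w_def intro: has_derivative_at_withinI\<close>)
  then show "((snd c' \<circ> (\<lambda>t. chart_inv c (u + t *\<^sub>R (v - u)))) has_vector_derivative
           frechet_derivative (transition c c') (at (u + t *\<^sub>R (v - u))) (v - u)) (at t within {0..1})"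
    by (simp add: transition_def o_def w_def)
qed

lemma (in smooth_manifold) segment_curve:
  assumes c: "c \<in> atlas" and sub: "closed_segment u v \<subseteq> snd c ` fst c"
  shows "(\<lambda>t. chart_inv c (u + t *\<^sub>R (v - u))) \<in> piecewise_C1_curves atlas (chart_inv c u) (chart_inv c v)"
proof -
  let ?l = "\<lambda>t::real. u + t *\<^sub>R (v - u)"
  let ?\<gamma> = "\<lambda>t. chart_inv c (?l t)"
  have line: "?l t \<in> snd c ` fst c" if "t \<in> {0..1}" for t
  proof -
    have "?l t \<in> closed_segment u v"
      by (rule segment_point_in_closed_segment[OF that])
    then show ?thesis using sub by auto
  qed
  have "continuous_on (snd c ` fst c) (chart_inv c)"
    using chart_homeomorphism[OF c] unfolding homeomorphism_def by auto
  then have cont: "continuous_on {0..1} ?\<gamma>"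
    by (rule continuous_on_compose2) (use line in \<open>auto intro!: continuous_intros\<close>)
  have "C1_curve_on atlas ?\<gamma> {0..1}"
    unfolding C1_curve_on_def
  proof (intro conjI cont ballI)
    fix c' assume c': "c' \<in> atlas"
    let ?D = "\<lambda>t. frechet_derivative (transition c c') (at (?l t)) (v - u)"
    have "Cn_on (Suc 0) (snd c ` (fst c \<inter> fst c')) (transition c c')"
      using transition_smooth[OF c c'] unfolding smooth_on_def by blast
    then have "continuous_on (snd c ` (fst c \<inter> fst c'))
        (\<lambda>w. frechet_derivative (transition c c') (at w) (v - u))" by simp
    then have "continuous_on {t \<in> {0..1}. ?\<gamma> t \<in> fst c'} ?D"
      by (rule continuous_on_compose2)
        (use segment_in_chart(2)[OF c sub c'] in \<open>auto intro!: continuous_intros\<close>)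
    then show "\<exists>D. (\<forall>t\<in>{0..1}. ?\<gamma> t \<in> fst c' \<longrightarrow>
          (snd c' \<circ> ?\<gamma> has_vector_derivative D t) (at t within {0..1})) \<and>
        continuous_on {t \<in> {0..1}. ?\<gamma> t \<in> fst c'} D"
      using segment_in_chart(1)[OF c sub c'] by (intro exI[of _ ?D]) blast
  qed
  then have "\<exists>(n::nat) s. s 0 = 0 \<and> s n = 1 \<and>
        (\<forall>i<n. s i < s (Suc i) \<and> C1_curve_on atlas ?\<gamma> {s i..s (Suc i)})"
    by (intro exI[of _ "1::nat"] exI[of _ "real"]) auto
  then show ?thesis unfolding piecewise_C1_curves_def by simp
qed

context riemannian_manifold
begin

lemma chosen_chart:
  fixes p defines "c \<equiv> (SOME c. c \<in> atlas \<and> p \<in> fst c)"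
  shows "c \<in> atlas" "p \<in> fst c"
proof -
  have "\<exists>c. c \<in> atlas \<and> p \<in> fst c" using atlas_cover by blast
  then have "c \<in> atlas \<and> p \<in> fst c" unfolding c_def by (rule someI_ex)
  then show "c \<in> atlas" "p \<in> fst c" by auto
qed

lemma g_nonneg:
  assumes "c \<in> atlas" "p \<in> fst c"
  shows "0 \<le> g c p v v"
proof (cases "v = 0")
  case True
  then show ?thesis using bilinear_lzero[OF g_bilinear[OF assms]] by simp
next
  case False
  then show ?thesis using g_positive[OF assms False] by simp
qed

lemma curve_speed_nonneg: "0 \<le> curve_speed atlas g \<gamma> t"
  unfolding curve_speed_def Let_def using g_nonneg[OF chosen_chart] by simp

lemma curve_length_nonneg: "0 \<le> curve_length atlas g \<gamma>"
  unfolding curve_length_def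
  by (cases "curve_speed atlas g \<gamma> integrable_on {0..1}")
    (auto simp: not_integrable_integral curve_speed_nonneg intro: Henstock_Kurzweil_Integration.integral_nonneg)

text \<open>
  The speed is computed in an unspecified chart around the point; the transformation law of \<open>g\<close>
  brings it back to the chart in which the curve is straight.
\<close>

lemma segment_speed:
  assumes c: "c \<in> atlas" and sub: "closed_segment u v \<subseteq> snd c ` fst c" and t: "0 < t" "t < 1"
  defines "w \<equiv> u + t *\<^sub>R (v - u)"
  shows "curve_speed atlas g (\<lambda>t. chart_inv c (u + t *\<^sub>R (v - u))) t
           = sqrt (g c (chart_inv c w) (v - u) (v - u))"
proof -
  let ?\<gamma> = "\<lambda>t. chart_inv c (u + t *\<^sub>R (v - u))"
  define c' where "c' = (SOME c. c \<in> atlas \<and> ?\<gamma> t \<in> fst c)"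
  have c': "c' \<in> atlas" "?\<gamma> t \<in> fst c'" unfolding c'_def by (rule chosen_chart)+
  have t': "t \<in> {0..1}" using t by auto
  have "at t within {0..1} = at t" using t by (intro at_within_interior) auto
  then have "vector_derivative (snd c' \<circ> ?\<gamma>) (at t) = frechet_derivative (transition c c') (at w) (v - u)"
    using segment_in_chart(1)[OF c sub c'(1) t' c'(2)] unfolding w_def
    by (metis vector_derivative_at)
  moreover have "w \<in> snd c ` fst c" "w \<in> snd c ` (fst c \<inter> fst c')"
    using segment_in_chart(2)[OF c sub c'(1) t' c'(2)] by (auto simp: w_def)
  then have "chart_inv c w \<in> fst c \<inter> fst c'" "snd c (chart_inv c w) = w"
    using chart_inv_point[OF c] c' by (auto simp: w_def)
  then have "g c (chart_inv c w) (v - u) (v - u) =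
     g c' (chart_inv c w) (frechet_derivative (transition c c') (at w) (v - u))
        (frechet_derivative (transition c c') (at w) (v - u))"
    using g_transforms[OF c c'(1), of "chart_inv c w" "v - u" "v - u"] by simp
  ultimately show ?thesis
    unfolding curve_speed_def Let_def c'_def[symmetric] by (simp add: w_def)
qed

text \<open>
  Continuity of the metric in the point is given for each pair of vectors separately; expanding \<open>v\<close> in
  the standard basis makes the bound uniform in \<open>v\<close>.
\<close>

lemma metric_bounded_on_compact:
  assumes c: "c \<in> atlas" and S: "compact S" "S \<subseteq> snd c ` fst c"
  obtains B where "0 \<le> B" "\<And>w v. w \<in> S \<Longrightarrow> g c (chart_inv c w) v v \<le> B * (norm v)\<^sup>2"
proof -
  have "\<exists>B. \<forall>w\<in>S. \<bar>g c (chart_inv c w) i j\<bar> \<le> B" for i j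
  proof -
    have "Cn_on 0 (snd c ` fst c) (\<lambda>u. g c (chart_inv c u) i j)"
      using g_smooth[OF c] unfolding smooth_on_def by blast
    then have "continuous_on S (\<lambda>u. g c (chart_inv c u) i j)"
      using S(2) by (auto intro: continuous_on_subset)
    then have "bounded ((\<lambda>u. g c (chart_inv c u) i j) ` S)"
      using S(1) compact_continuous_image compact_imp_bounded by blast
    then show ?thesis by (auto simp: bounded_iff)
  qed
  then obtain b where b: "\<And>i j w. w \<in> S \<Longrightarrow> \<bar>g c (chart_inv c w) i j\<bar> \<le> b i j" by metis
  let ?B = "\<Sum>(i,j)\<in>Basis \<times> Basis. \<bar>b i j\<bar>"
  have "g c (chart_inv c w) v v \<le> ?B * (norm v)\<^sup>2" if w: "w \<in> S" for w v
  proof -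
    have bil: "bilinear (g c (chart_inv c w))"
      using g_bilinear[OF c chart_inv_point(1)[OF c]] w S(2) by blast
    have "g c (chart_inv c w) v v =
       g c (chart_inv c w) (\<Sum>i\<in>Basis. (v \<bullet> i) *\<^sub>R i) (\<Sum>i\<in>Basis. (v \<bullet> i) *\<^sub>R i)"
      by (simp add: euclidean_representation)
    also have "\<dots> = (\<Sum>(i,j)\<in>Basis \<times> Basis. (v \<bullet> i) * (v \<bullet> j) * g c (chart_inv c w) i j)"
      unfolding bilinear_sum[OF bil] by (rule sum.cong)
        (auto simp: bilinear_lmul[OF bil] bilinear_rmul[OF bil])
    also have "\<dots> \<le> (\<Sum>(i,j)\<in>Basis \<times> Basis. \<bar>b i j\<bar> * (norm v)\<^sup>2)"
    proof (rule sum_mono, clarsimp)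
      fix i j :: 'e assume ij: "i \<in> Basis" "j \<in> Basis"
      have "(v \<bullet> i) * (v \<bullet> j) * g c (chart_inv c w) i j
              \<le> \<bar>v \<bullet> i\<bar> * \<bar>v \<bullet> j\<bar> * \<bar>g c (chart_inv c w) i j\<bar>"
        by (metis abs_ge_self abs_mult)
      also have "\<dots> \<le> norm v * norm v * \<bar>b i j\<bar>"
        using Basis_le_norm[OF ij(1)] Basis_le_norm[OF ij(2)] b[OF w, of i j]
        by (intro mult_mono) auto
      finally show "(v \<bullet> i) * (v \<bullet> j) * g c (chart_inv c w) i j \<le> \<bar>b i j\<bar> * (norm v)\<^sup>2"
        by (simp add: power2_eq_square mult_ac)
    qed
    also have "\<dots> = ?B * (norm v)\<^sup>2" by (simp add: sum_distrib_right case_prod_unfold)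
    finally show ?thesis .
  qed
  then show ?thesis by (intro that[of ?B]) (auto intro: sum_nonneg)
qed

text \<open>
  The geodesic distance between two points is at most the length of the curve that is straight in a
  chart, and on a compact ball of the chart that length is at most a constant times the Euclidean
  distance.
\<close>

lemma chart_inv_locally_lipschitz:
  obtains c r L where "c \<in> atlas" "p \<in> fst c" "0 < r" "cball (snd c p) r \<subseteq> snd c ` fst c"
    "L-lipschitz_on (cball (snd c p) r) (chart_inv c)"
proof -
  obtain c where c: "c \<in> atlas" "p \<in> fst c" using chosen_chart by blast
  then obtain r where r: "0 < r" "cball (snd c p) r \<subseteq> snd c ` fst c"
    using chart_open[OF c(1)] by (metis imageI open_contains_cball)
  obtain B where B: "0 \<le> B"
    "\<And>w v. w \<in> cball (snd c p) r \<Longrightarrow> g c (chart_inv c w) v v \<le> B * (norm v)\<^sup>2"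
    using metric_bounded_on_compact[OF c(1) compact_cball r(2)] by blast
  have "dist (chart_inv c u) (chart_inv c v) \<le> sqrt B * dist u v"
    if uv: "u \<in> cball (snd c p) r" "v \<in> cball (snd c p) r" for u v
  proof -
    let ?\<gamma> = "\<lambda>t. chart_inv c (u + t *\<^sub>R (v - u))"
    have seg: "closed_segment u v \<subseteq> cball (snd c p) r"
      using uv by (simp add: closed_segment_subset)
    then have sub: "closed_segment u v \<subseteq> snd c ` fst c" using r(2) by blast
    have speed: "curve_speed atlas g ?\<gamma> t \<le> sqrt B * dist u v" if t: "t \<in> {0..1} - {0, 1}" for t
    proof -
      have "u + t *\<^sub>R (v - u) \<in> closed_segment u v"
        using t by (intro segment_point_in_closed_segment) auto
      then have "g c (?\<gamma> t) (v - u) (v - u) \<le> B * (norm (v - u))\<^sup>2" using B(2) seg by blast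
      then have "sqrt (g c (?\<gamma> t) (v - u) (v - u)) \<le> sqrt B * norm (v - u)"
        by (metis norm_ge_zero real_sqrt_abs abs_of_nonneg real_sqrt_le_iff real_sqrt_mult)
      then show ?thesis
        using segment_speed[OF c(1) sub, of t] t by (simp add: dist_norm norm_minus_commute)
    qed
    have "curve_length atlas g ?\<gamma> \<le> sqrt B * dist u v"
    proof (cases "curve_speed atlas g ?\<gamma> integrable_on {0..1}")
      case True
      then have "(curve_speed atlas g ?\<gamma> has_integral curve_length atlas g ?\<gamma>) (cbox 0 1)"
        unfolding curve_length_def by (simp add: integrable_integral)
      from has_integral_bound_spike_finite[OF _ _ this, of "sqrt B * dist u v" "{0,1}"]
      show ?thesis using B(1) speed curve_speed_nonneg by auto
    next
      case False
      then show ?thesis using B(1) by (simp add: curve_length_def not_integrable_integral)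
    qed
    moreover have "?\<gamma> \<in> piecewise_C1_curves atlas (chart_inv c u) (chart_inv c v)"
      by (rule segment_curve[OF c(1) sub])
    moreover have "(INF \<gamma>\<in>piecewise_C1_curves atlas (chart_inv c u) (chart_inv c v). curve_length atlas g \<gamma>)
        \<le> curve_length atlas g ?\<gamma>"
      using calculation(2) by (intro cINF_lower bdd_belowI2[of _ 0]) (auto intro: curve_length_nonneg)
    ultimately show ?thesis using dist_geodesic[of "chart_inv c u" "chart_inv c v"] by force
  qed
  then have "(sqrt B)-lipschitz_on (cball (snd c p) r) (chart_inv c)"
    using B(1) by (intro lipschitz_onI) auto
  then show ?thesis using that c r by blast
qed

end

text \<open>
  The set has upper box dimension at most \<open>D\<close>, with an explicit constant.
\<close>

definition polynomially_coverable :: "real \<Rightarrow> 'a::metric_space set \<Rightarrow> bool" where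
  "polynomially_coverable D S \<longleftrightarrow> (\<exists>K. \<forall>\<rho>. 0 < \<rho> \<longrightarrow> \<rho> \<le> 1 \<longrightarrow>
     (\<exists>F. finite F \<and> real (card F) \<le> K * \<rho> powr - D \<and> S \<subseteq> (\<Union>x\<in>F. ball x \<rho>)))"

lemma polynomially_coverable_subset:
  "polynomially_coverable D T \<Longrightarrow> S \<subseteq> T \<Longrightarrow> polynomially_coverable D S"
  unfolding polynomially_coverable_def by (meson order_trans)

lemma polynomially_coverable_Un:
  assumes "polynomially_coverable D S" "polynomially_coverable D T"
  shows "polynomially_coverable D (S \<union> T)"
proof -
  from assms obtain K1 K2 where
    K1: "\<And>\<rho>. 0 < \<rho> \<Longrightarrow> \<rho> \<le> 1 \<Longrightarrow>
      \<exists>F. finite F \<and> real (card F) \<le> K1 * \<rho> powr - D \<and> S \<subseteq> (\<Union>x\<in>F. ball x \<rho>)" and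
    K2: "\<And>\<rho>. 0 < \<rho> \<Longrightarrow> \<rho> \<le> 1 \<Longrightarrow>
      \<exists>F. finite F \<and> real (card F) \<le> K2 * \<rho> powr - D \<and> T \<subseteq> (\<Union>x\<in>F. ball x \<rho>)"
    unfolding polynomially_coverable_def by metis
  show ?thesis unfolding polynomially_coverable_def
  proof (intro exI[of _ "K1 + K2"] allI impI)
    fix \<rho> :: real assume \<rho>: "0 < \<rho>" "\<rho> \<le> 1"
    obtain F where F: "finite F" "real (card F) \<le> K1 * \<rho> powr - D" "S \<subseteq> (\<Union>x\<in>F. ball x \<rho>)"
      using K1[OF \<rho>] by blast
    obtain G where G: "finite G" "real (card G) \<le> K2 * \<rho> powr - D" "T \<subseteq> (\<Union>x\<in>G. ball x \<rho>)"
      using K2[OF \<rho>] by blast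
    have "real (card (F \<union> G)) \<le> real (card F) + real (card G)"
      by (metis card_Un_le of_nat_add of_nat_le_iff)
    also have "\<dots> \<le> (K1 + K2) * \<rho> powr - D" using F(2) G(2) by (simp add: distrib_right)
    finally show "\<exists>F. finite F \<and> real (card F) \<le> (K1 + K2) * \<rho> powr - D \<and> S \<union> T \<subseteq> (\<Union>x\<in>F. ball x \<rho>)"
      using F G by (intro exI[of _ "F \<union> G"]) auto
  qed
qed

lemma polynomially_coverable_UN:
  assumes "finite I" "\<And>i. i \<in> I \<Longrightarrow> polynomially_coverable D (S i)"
  shows "polynomially_coverable D (\<Union>i\<in>I. S i)"
  using assms
proof (induction I)
  case empty
  show ?case unfolding polynomially_coverable_def by (intro exI[of _ 1]) force
qed (auto intro: polynomially_coverable_Un)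

text \<open>
  Halving the radius multiplies the number of balls by at most the number \<open>Q\<close> of balls of radius 1/2
  that cover the unit ball, by scaling and translation. This gives a polynomial covering number
  with exponent \<open>log 2 Q\<close>, which is not optimal but suffices here.
\<close>

lemma dyadic_covering:
  obtains Q :: nat where "1 \<le> Q"
    "\<And>n (a::'e::euclidean_space) R. 0 < R \<Longrightarrow>
       \<exists>F. finite F \<and> card F \<le> Q ^ n \<and> cball a R \<subseteq> (\<Union>x\<in>F. cball x (R / 2 ^ n))"
proof -
  obtain F0 :: "'e set" where F0: "finite F0" "cball 0 1 \<subseteq> (\<Union>x\<in>F0. ball x (1/2))"
  proof (rule compactE_image[OF compact_cball[of "0::'e" 1], of UNIV "\<lambda>x. ball x (1/2)"])
    show "cball 0 1 \<subseteq> (\<Union>x. ball (x::'e) (1 / 2))" 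
      by (rule subsetI, rule_tac a = x in UN_I) auto
  qed auto
  let ?Q = "card F0"
  have "F0 \<noteq> {}" using F0(2) by force
  then have "1 \<le> ?Q" using F0(1) by (simp add: Suc_leI card_gt_0_iff)
  moreover have "\<exists>F. finite F \<and> card F \<le> ?Q ^ n \<and> cball a R \<subseteq> (\<Union>x\<in>F. cball x (R / 2 ^ n))"
    if R: "0 < R" for n and a :: 'e and R
  proof (induction n)
    case 0
    show ?case by (intro exI[of _ "{a}"]) auto
  next
    case (Suc n)
    then obtain F where F: "finite F" "card F \<le> ?Q ^ n" "cball a R \<subseteq> (\<Union>x\<in>F. cball x (R / 2 ^ n))"
      by blast
    let ?h = "\<lambda>(x, y). x + (R / 2 ^ n) *\<^sub>R y"
    let ?G = "?h ` (F \<times> F0)"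
    have "card ?G \<le> ?Q ^ Suc n"
    proof -
      have "card ?G \<le> card (F \<times> F0)" by (rule card_image_le) (use F(1) F0(1) in auto)
      also have "\<dots> \<le> ?Q ^ n * ?Q"
        unfolding card_cartesian_product by (rule mult_le_mono1[OF F(2)])
      finally show ?thesis by (simp add: mult.commute)
    qed
    moreover have "z \<in> (\<Union>x\<in>?G. cball x (R / 2 ^ Suc n))" if z: "z \<in> cball a R" for z
    proof -
      obtain x where x: "x \<in> F" "dist x z \<le> R / 2 ^ n" using z F(3) by fastforce
      let ?w = "(2 ^ n / R) *\<^sub>R (z - x)"
      have "norm ?w = 2 ^ n / R * dist x z" using R by (simp add: dist_norm norm_minus_commute)
      moreover have "2 ^ n / R * dist x z \<le> 1" using x(2) R by (simp add: field_simps)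
      ultimately have "norm ?w \<le> 1" by linarith
      then have "?w \<in> cball 0 1" by simp
      then obtain y where y: "y \<in> F0" "dist y ?w < 1/2" using F0(2) by fastforce
      have "z - (x + (R / 2 ^ n) *\<^sub>R y) = (R / 2 ^ n) *\<^sub>R (?w - y)"
        using R by (simp add: algebra_simps)
      then have "dist (x + (R / 2 ^ n) *\<^sub>R y) z = (R / 2 ^ n) * dist y ?w"
        using R by (simp add: dist_norm norm_minus_commute)
      also have "\<dots> \<le> (R / 2 ^ n) * (1/2)" using y(2) R by (intro mult_left_mono) auto
      also have "\<dots> = R / 2 ^ Suc n" by simp
      finally show ?thesis using x(1) y(1) by force
    qed
    ultimately show ?case using F(1) F0(1) by (intro exI[of _ ?G]) blast
  qed
  ultimately show ?thesis using that by blast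
qed

lemma between_powers_of_two:
  assumes "1 \<le> (x::real)"
  obtains m :: nat where "2 ^ m \<le> x" "x < 2 ^ (m + 1)"
proof -
  define m where "m = nat \<lfloor>log 2 x\<rfloor>"
  have "0 \<le> log 2 x" using assms by simp
  then have m: "real m \<le> log 2 x" "log 2 x < real (m + 1)" unfolding m_def by linarith+
  have "2 powr real m \<le> x" using m(1) assms by (simp add: le_log_iff)
  moreover have "x < 2 powr real (m + 1)" using m(2) assms by (simp add: less_powr_iff)
  ultimately show ?thesis using that by (metis powr_realpow zero_less_numeral)
qed

text \<open>
  The exponent depends on the Euclidean space alone, so that finitely many chart balls can later be
  put together.
\<close>

lemma polynomially_coverable_lipschitz_image:
  obtains D where "0 \<le> D"
    "\<And>(a::'e::euclidean_space) R L (f::'e \<Rightarrow> 'a::metric_space). 0 < R \<Longrightarrow>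
       L-lipschitz_on (cball a R) f \<Longrightarrow> polynomially_coverable D (f ` cball a R)"
proof -
  obtain Q :: nat where Q: "1 \<le> Q"
    "\<And>n (a::'e) R. 0 < R \<Longrightarrow>
       \<exists>F. finite F \<and> card F \<le> Q ^ n \<and> cball a R \<subseteq> (\<Union>x\<in>F. cball x (R / 2 ^ n))"
    using dyadic_covering by metis
  define D where "D = log 2 (real Q)"
  have D: "0 \<le> D" "2 powr D = real Q" using Q(1) by (auto simp: D_def)
  have "polynomially_coverable D (f ` cball a R)"
    if R: "0 < R" and L: "L-lipschitz_on (cball a R) f" for a :: 'e and R L and f :: "'e \<Rightarrow> 'a"
  proof -
    \<comment> \<open>The bound \<open>1 / R\<close> guarantees \<open>R * L' \<ge> 1\<close>, so that \<open>4 * R * L' / \<rho>\<close> below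
      lies between two powers of 2 with natural exponents.\<close>
    define L' where "L' = max 1 (max L (1 / R))"
    have L': "1 \<le> L'" "L \<le> L'" "1 / R \<le> L'" by (auto simp: L'_def)
    have RL': "1 \<le> R * L'" using L'(3) R by (simp add: divide_le_eq mult.commute)
    define K where "K = real Q * (4 * R * L') powr D"
    show ?thesis unfolding polynomially_coverable_def
    proof (intro exI[of _ K] allI impI)
      fix \<rho> :: real assume \<rho>: "0 < \<rho>" "\<rho> \<le> 1"
      have "1 \<le> 4 * R * L' / \<rho>" using RL' \<rho> by (simp add: field_simps)
      then obtain m where m: "2 ^ m \<le> 4 * R * L' / \<rho>" "4 * R * L' / \<rho> < 2 ^ (m + 1)"
        using between_powers_of_two by blast
      obtain F where F: "finite F" "card F \<le> Q ^ (m + 1)" "cball a R \<subseteq> (\<Union>x\<in>F. cball x (R / 2 ^ (m + 1)))"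
        using Q(2)[OF R] by blast
      \<comment> \<open>The centres may lie outside the ball, where the map is not controlled; they are moved into it
        at the cost of doubling the radius.\<close>
      define pick where "pick x = (SOME z. z \<in> cball a R \<and> z \<in> cball x (R / 2 ^ (m + 1)))" for x
      have pick: "pick x \<in> cball a R \<and> pick x \<in> cball x (R / 2 ^ (m + 1))"
        if "z \<in> cball a R" "z \<in> cball x (R / 2 ^ (m + 1))" for x z
        unfolding pick_def by (rule someI[of _ z]) (use that in blast)
      let ?G = "(f \<circ> pick) ` F"
      have "real (card ?G) \<le> real (Q ^ (m + 1))"
        using F(2) card_image_le[OF F(1), of "f \<circ> pick"] by linarith
      also have "\<dots> = real Q * (2 ^ m) powr D"
        by (simp add: D(2)[symmetric] powr_powr flip: powr_realpow) (simp add: mult.commute)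
      also have "\<dots> \<le> real Q * (4 * R * L' / \<rho>) powr D"
        using m(1) D(1) by (intro mult_left_mono powr_mono2) auto
      also have "\<dots> = K * \<rho> powr - D"
        using R L'(1) \<rho> by (simp add: K_def powr_divide powr_minus field_simps)
      finally have "real (card ?G) \<le> K * \<rho> powr - D" .
      moreover have "f w \<in> (\<Union>x\<in>?G. ball x \<rho>)" if w: "w \<in> cball a R" for w
      proof -
        obtain x where x: "x \<in> F" "w \<in> cball x (R / 2 ^ (m + 1))" using F(3) w by blast
        note p = pick[OF w x(2)]
        have "dist (pick x) w \<le> dist x (pick x) + dist x w" by (metis dist_commute dist_triangle)
        also have "\<dots> \<le> 2 * (R / 2 ^ (m + 1))" using p x(2) by simp
        finally have dw: "dist (pick x) w \<le> 2 * (R / 2 ^ (m + 1))" .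
        have "dist (f (pick x)) (f w) \<le> L * dist (pick x) w"
          using lipschitz_onD[OF L] p w by blast
        also have "\<dots> \<le> L' * (2 * (R / 2 ^ (m + 1)))"
          using L' dw by (intro mult_mono) auto
        also have "\<dots> < \<rho>"
        proof -
          have "4 * R * L' < 2 ^ (m + 1) * \<rho>" using m(2) \<rho>(1) by (simp add: divide_less_eq)
          then have "4 * R * L' / 2 ^ (m + 1) < \<rho>" by (simp add: divide_less_eq mult.commute)
          moreover have "L' * (2 * (R / 2 ^ (m + 1))) \<le> 4 * R * L' / 2 ^ (m + 1)"
            using R L' by (simp add: field_simps)
          ultimately show ?thesis by simp
        qed
        finally show ?thesis using x(1) by auto
      qed
      ultimately show "\<exists>F. finite F \<and> real (card F) \<le> K * \<rho> powr - D \<and> f ` cball a R \<subseteq> (\<Union>x\<in>F. ball x \<rho>)"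
        using F(1) by (intro exI[of _ ?G]) auto
    qed
  qed
  then show ?thesis using that D(1) by blast
qed

lemma (in compact_riemannian_manifold) polynomially_coverable_UNIV:
  obtains D where "0 \<le> D" "polynomially_coverable D (UNIV :: 'a set)"
proof -
  obtain D where D: "0 \<le> D"
    "\<And>(a::'e) R L (f::'e \<Rightarrow> 'a). 0 < R \<Longrightarrow>
       L-lipschitz_on (cball a R) f \<Longrightarrow> polynomially_coverable D (f ` cball a R)"
    using polynomially_coverable_lipschitz_image by metis
  have "\<exists>W. open W \<and> p \<in> W \<and> polynomially_coverable D W" for p :: 'a
  proof -
    obtain c r L where c: "c \<in> atlas" "p \<in> fst c" "0 < r" "cball (snd c p) r \<subseteq> snd c ` fst c"
      and L: "L-lipschitz_on (cball (snd c p) r) (chart_inv c)"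
      using chart_inv_locally_lipschitz by blast
    let ?W = "fst c \<inter> snd c -` ball (snd c p) r"
    have "continuous_on (fst c) (snd c)" and inv: "\<And>x. x \<in> fst c \<Longrightarrow> chart_inv c (snd c x) = x"
      using chart_homeomorphism[OF c(1)] unfolding homeomorphism_def by auto
    then have "open ?W" using chart_open[OF c(1)] by (auto intro: continuous_open_preimage)
    moreover have "?W \<subseteq> chart_inv c ` cball (snd c p) r"
    proof
      fix x assume x: "x \<in> ?W"
      then have "snd c x \<in> cball (snd c p) r" by auto
      then have "chart_inv c (snd c x) \<in> chart_inv c ` cball (snd c p) r" by (rule imageI)
      then show "x \<in> chart_inv c ` cball (snd c p) r" using inv x by simp
    qed
    then have "polynomially_coverable D ?W"
      using D(2)[OF c(3) L] polynomially_coverable_subset by blast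
    moreover have "p \<in> ?W" using c by simp
    ultimately show ?thesis by blast
  qed
  then have "\<exists>W. \<forall>p::'a. open (W p) \<and> p \<in> W p \<and> polynomially_coverable D (W p)"
    by (intro choice) blast
  then obtain W where W: "\<And>p::'a. open (W p)" "\<And>p. p \<in> W p" "\<And>p. polynomially_coverable D (W p)"
    by blast
  obtain P where P: "finite P" "UNIV \<subseteq> (\<Union>p\<in>P. W p)"
    by (rule compactE_image[OF compact_space, of UNIV W]) (use W in auto)
  then have "polynomially_coverable D (\<Union>p\<in>P. W p)"
    using W(3) by (intro polynomially_coverable_UN) auto
  then have "polynomially_coverable D (UNIV :: 'a set)"
    using P(2) by (metis top.extremum_uniqueI)
  then show ?thesis using that D(1) by blast
qed

section \<open>Lipschitz cut-offs and partitions of unity\<close>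

text \<open>
  A piecewise linear approximation of the indicator of \<open>t \<le> a\<close> that vanishes for \<open>t \<ge> a + \<rho>\<close>. For
  \<open>a + \<rho> \<le> 0\<close> and \<open>t \<ge> 0\<close> it is identically 0, so balls of negative radius need no separate treatment.
\<close>

definition cutoff :: "real \<Rightarrow> real \<Rightarrow> real \<Rightarrow> real" where
  "cutoff a \<rho> t = max 0 (min 1 ((a + \<rho> - t) / \<rho>))"

text \<open>
  The constant 2 leaves room for differences of two \<open>1/\<rho>\<close>-Lipschitz functions, which is what the
  partition of unity consists of.
\<close>

definition test_functions :: "real \<Rightarrow> ('a::metric_space \<Rightarrow> real) set" where
  "test_functions \<rho> = {\<phi>. (\<forall>x. 0 \<le> \<phi> x \<and> \<phi> x \<le> 1) \<and> (2 / \<rho>)-lipschitz_on UNIV \<phi>}"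

lemma cutoff_nonneg: "0 \<le> cutoff a \<rho> t" and cutoff_le_1: "cutoff a \<rho> t \<le> 1"
  by (auto simp: cutoff_def)

lemma cutoff_eq_1: "0 < \<rho> \<Longrightarrow> t \<le> a \<Longrightarrow> cutoff a \<rho> t = 1"
  by (simp add: cutoff_def field_simps max_def min_def)

lemma cutoff_eq_0: "0 < \<rho> \<Longrightarrow> a + \<rho> \<le> t \<Longrightarrow> cutoff a \<rho> t = 0"
  using divide_nonpos_pos[of "a + \<rho> - t" \<rho>] by (simp add: cutoff_def)

lemma lipschitz_cutoff_dist:
  assumes "0 < \<rho>"
  shows "(1 / \<rho>)-lipschitz_on UNIV (\<lambda>z. cutoff a \<rho> (dist y z))"
proof (rule lipschitz_onI)
  fix z w
  have "dist (cutoff a \<rho> (dist y z)) (cutoff a \<rho> (dist y w))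
      \<le> \<bar>(a + \<rho> - dist y z) / \<rho> - (a + \<rho> - dist y w) / \<rho>\<bar>"
    unfolding cutoff_def dist_real_def by linarith
  also have "\<dots> = \<bar>dist y z - dist y w\<bar> / \<rho>"
    using assms by (simp add: diff_divide_distrib[symmetric] abs_minus_commute)
  also have "\<dots> \<le> dist z w / \<rho>"
    using assms by (intro divide_right_mono) (metis abs_dist_diff_le dist_commute, simp)
  finally show "dist (cutoff a \<rho> (dist y z)) (cutoff a \<rho> (dist y w)) \<le> 1 / \<rho> * dist z w" by simp
qed (use assms in simp)

lemma cutoff_test_function:
  assumes "0 < \<rho>"
  shows "(\<lambda>z. cutoff a \<rho> (dist y z)) \<in> test_functions \<rho>"
  using lipschitz_on_le[OF lipschitz_cutoff_dist[OF assms], of "2 / \<rho>" a y] assms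
  by (simp add: test_functions_def cutoff_nonneg cutoff_le_1 divide_right_mono)

lemma lip_norm_bounds:
  fixes f :: "'a::metric_space \<Rightarrow> real"
  assumes "\<And>x. \<bar>f x\<bar> \<le> B" and L: "L-lipschitz_on UNIV f"
  shows "0 \<le> lip_norm f" "lip_norm f \<le> B + L"
proof -
  have "bdd_above (range (\<lambda>x. \<bar>f x\<bar>))" using assms(1) by (intro bdd_aboveI2) auto
  then have s: "0 \<le> sup_norm f" unfolding sup_norm_def
    by (intro cSUP_upper2[of _ _ undefined]) auto
  have q: "\<bar>f x - f y\<bar> / dist x y \<le> L" for x y
  proof (cases "x = y")
    case True
    then show ?thesis using lipschitz_on_nonneg[OF L] by simp
  next
    case False
    then show ?thesis using lipschitz_onD[OF L, of x y] by (simp add: dist_real_def divide_le_eq)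
  qed
  have "bdd_above (range (\<lambda>(x, y). \<bar>f x - f y\<bar> / dist x y))"
    using q by (intro bdd_aboveI2[of _ _ L]) auto
  then have l: "0 \<le> lip_seminorm f" unfolding lip_seminorm_def
    by (intro cSUP_upper2[of _ _ "undefined"]) (auto split: prod.splits)
  have "sup_norm f \<le> B" unfolding sup_norm_def by (intro cSUP_least) (use assms(1) in auto)
  moreover have "lip_seminorm f \<le> L" unfolding lip_seminorm_def
    by (intro cSUP_least) (use q in auto)
  ultimately show "0 \<le> lip_norm f" "lip_norm f \<le> B + L"
    using s l unfolding lip_norm_def by auto
qed

lemma test_functionD:
  assumes "\<phi> \<in> test_functions \<rho>"
  shows "0 \<le> \<phi> x" "\<phi> x \<le> 1" "nonneg_lipschitz \<phi>"
  using assms unfolding test_functions_def nonneg_lipschitz_def by auto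

lemma test_function_lip_norm:
  assumes "\<phi> \<in> test_functions \<rho>" "0 < \<rho>" "\<rho> \<le> 1"
  shows "0 \<le> lip_norm \<phi>" "lip_norm \<phi> \<le> 3 / \<rho>"
proof -
  have L: "(2 / \<rho>)-lipschitz_on UNIV \<phi>" using assms unfolding test_functions_def by auto
  have "\<bar>\<phi> x\<bar> \<le> 1" for x using test_functionD[OF assms(1)] by simp
  note b = lip_norm_bounds[OF this L]
  show "0 \<le> lip_norm \<phi>" by (rule b)
  have "1 + 2 / \<rho> \<le> 3 / \<rho>" using assms by (simp add: field_simps)
  with b(2) show "lip_norm \<phi> \<le> 3 / \<rho>" by simp
qed

text \<open>
  Let \<open>\<chi>\<^sub>y\<close> be a \<open>1/\<rho>\<close>-Lipschitz cut-off of the ball around \<open>y\<close>. Enumerating the centres, the functions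
  \<open>max\<^bsub>j\<le>i\<^esub> \<chi>\<^sub>j - max\<^bsub>j<i\<^esub> \<chi>\<^sub>j\<close> telescope to the maximum of all cut-offs, which is 1. Maxima do not increase
  Lipschitz constants, so the constant \<open>2/\<rho>\<close> does not depend on the number of centres.
\<close>

lemma lipschitz_partition_of_unity:
  fixes F :: "'a::metric_space set"
  assumes \<rho>: "0 < \<rho>" and F: "finite F" "UNIV \<subseteq> (\<Union>y\<in>F. ball y \<rho>)"
  obtains \<psi> where "\<And>y. \<psi> y \<in> test_functions \<rho>" "\<And>x. (\<Sum>y\<in>F. \<psi> y x) = 1"
    "\<And>x y. y \<in> F \<Longrightarrow> \<psi> y x \<noteq> 0 \<Longrightarrow> dist y x < 2 * \<rho>"
proof -
  have "\<exists>\<psi> m. (\<forall>y. \<psi> y \<in> test_functions \<rho>) \<and> (\<forall>x. (\<Sum>y\<in>F. \<psi> y x) = m x) \<and>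
      (\<forall>x. \<forall>y\<in>F. \<psi> y x \<noteq> 0 \<longrightarrow> dist y x < 2 * \<rho>) \<and> (1 / \<rho>)-lipschitz_on UNIV m \<and>
      (\<forall>x. 0 \<le> m x \<and> m x \<le> 1) \<and> (\<forall>x. \<forall>y\<in>F. dist y x < \<rho> \<longrightarrow> m x = 1)"
    using F(1)
  proof (induction F)
    case empty
    show ?case
      by (intro exI[of _ "\<lambda>_ _. 0"]) (use \<rho> in \<open>auto simp: test_functions_def intro!: lipschitz_onI\<close>)
  next
    case (insert p F)
    then obtain \<psi> m where \<psi>: "\<And>y. \<psi> y \<in> test_functions \<rho>" "\<And>x. (\<Sum>y\<in>F. \<psi> y x) = m x"
      "\<And>x y. y \<in> F \<Longrightarrow> \<psi> y x \<noteq> 0 \<Longrightarrow> dist y x < 2 * \<rho>"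
      and m: "(1 / \<rho>)-lipschitz_on UNIV m" "\<And>x. 0 \<le> m x" "\<And>x. m x \<le> 1"
      "\<And>x y. y \<in> F \<Longrightarrow> dist y x < \<rho> \<Longrightarrow> m x = 1"
      by metis
    let ?\<chi> = "\<lambda>x. cutoff \<rho> \<rho> (dist p x)"
    let ?m = "\<lambda>x. max (m x) (?\<chi> x)"
    let ?\<psi> = "\<psi>(p := \<lambda>x. ?m x - m x)"
    have lip: "(1 / \<rho>)-lipschitz_on UNIV ?m"
    proof (rule lipschitz_onI)
      fix x y
      have "dist (?m x) (?m y) \<le> max (dist (m x) (m y)) (dist (?\<chi> x) (?\<chi> y))"
        unfolding dist_real_def by linarith
      then show "dist (?m x) (?m y) \<le> 1 / \<rho> * dist x y"
        using lipschitz_onD[OF m(1), of x y] lipschitz_onD[OF lipschitz_cutoff_dist[OF \<rho>, of \<rho> p], of x y]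
        by simp
    qed (use \<rho> in simp)
    have "(2 / \<rho>)-lipschitz_on UNIV (\<lambda>x. ?m x - m x)"
      using lipschitz_on_diff[OF lip m(1)] by simp
    moreover have "0 \<le> ?m x - m x" "?m x - m x \<le> 1" for x
      using m(2,3)[of x] cutoff_le_1[of \<rho> \<rho> "dist p x"] by (simp, linarith)
    ultimately have "\<forall>y. ?\<psi> y \<in> test_functions \<rho>"
      using \<psi>(1) by (simp add: test_functions_def)
    moreover have "(\<Sum>y\<in>insert p F. ?\<psi> y x) = ?m x" for x
    proof -
      have "(\<Sum>y\<in>F. ?\<psi> y x) = (\<Sum>y\<in>F. \<psi> y x)"
        using insert.hyps by (intro sum.cong) auto
      then show ?thesis using insert.hyps \<psi>(2) by simp
    qed
    moreover have "dist y x < 2 * \<rho>" if "y \<in> insert p F" "?\<psi> y x \<noteq> 0" for x y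
    proof (cases "y = p")
      case True
      then have "?\<chi> x \<noteq> 0" using that(2) m(2)[of x] by auto
      then show ?thesis using True cutoff_eq_0[OF \<rho>, of \<rho> "dist p x"] by fastforce
    next
      case False
      then show ?thesis using that \<psi>(3) by simp
    qed
    moreover have "?m x = 1" if "y \<in> insert p F" "dist y x < \<rho>" for x y
      using that m(4)[of _ x] m(3)[of x] cutoff_eq_1[OF \<rho>, of "dist p x" \<rho>] cutoff_le_1[of \<rho> \<rho> "dist p x"]
      by (auto simp: max_def)
    moreover have "0 \<le> ?m x \<and> ?m x \<le> 1" for x
      using m(2,3)[of x] cutoff_le_1[of \<rho> \<rho> "dist p x"] by auto
    ultimately show ?case using lip by (intro exI[of _ ?\<psi>] exI[of _ ?m]) blast
  qed
  then obtain \<psi> m where \<psi>: "\<And>y. \<psi> y \<in> test_functions \<rho>" "\<And>x. (\<Sum>y\<in>F. \<psi> y x) = m x"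
      "\<And>x y. y \<in> F \<Longrightarrow> \<psi> y x \<noteq> 0 \<Longrightarrow> dist y x < 2 * \<rho>"
      and m: "\<And>x y. y \<in> F \<Longrightarrow> dist y x < \<rho> \<Longrightarrow> m x = 1"
    by metis
  have "m x = 1" for x using F(2) m by fastforce
  then show ?thesis using that \<psi> by metis
qed

lemma lip_norm_const_1: "lip_norm (\<lambda>x::'a::metric_space. 1) = 1"
  by (simp add: lip_norm_def sup_norm_def lip_seminorm_def case_prod_unfold)

section \<open>Hoelder continuity of the mass of balls\<close>

text \<open>
  If the increment \<open>b - a\<close> of the radius is at most \<open>a\<close>, this is the thin annuli condition; otherwise the
  whole larger ball has radius at most \<open>2 (b - a)\<close> and the Frostman condition bounds its mass. Increments
  that are not small are harmless because masses are at most 1, so \<open>b\<close> may be arbitrary. Negative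
  values of \<open>a\<close> (empty balls) are included.
\<close>

lemma ball_mass_modulus:
  fixes \<mu> :: "'a::metric_space measure"
  assumes "prob_space \<mu>" and borel: "sets \<mu> = sets borel" and "frostman \<mu>" "thin_annuli \<mu>"
  obtains A \<beta> r where "0 < A" "0 < \<beta>" "0 < r"
    "\<And>x a b. a \<le> b \<Longrightarrow> a \<le> r \<Longrightarrow>
       measure \<mu> (ball x b) \<le> measure \<mu> (ball x a) + A * (b - a) powr \<beta>"
proof -
  interpret prob_space \<mu> by fact
  obtain Cf s where f: "0 < Cf" "0 < s"
    and ev: "\<forall>\<^sub>F r in at_right 0. \<forall>x. measure \<mu> (ball x r) \<le> Cf * r powr s"
    using assms(3) unfolding frostman_def by blast
  obtain rf where rf: "0 < rf" "\<And>r x. 0 < r \<Longrightarrow> r < rf \<Longrightarrow> measure \<mu> (ball x r) \<le> Cf * r powr s"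
    using ev unfolding eventually_at_right_field by blast
  obtain Ct \<alpha> rt where t: "0 < Ct" "0 < \<alpha>" "0 < rt" "\<And>\<epsilon> r x. 0 < \<epsilon> \<Longrightarrow> \<epsilon> \<le> r \<Longrightarrow> r \<le> rt \<Longrightarrow>
        measure \<mu> (ball x (r + \<epsilon>) - ball x r) \<le> Ct * \<epsilon> powr \<alpha>"
    using assms(4) unfolding thin_annuli_def by metis
  define r where "r = min (1/2) (min (rf / 2) rt)"
  define \<beta> where "\<beta> = min \<alpha> s"
  define A where "A = Ct + Cf * 2 powr s + (1 / r) powr \<beta>"
  have r: "0 < r" "r \<le> 1/2" "2 * r \<le> rf" "r \<le> rt" using rf(1) t(3) by (auto simp: r_def)
  have \<beta>: "0 < \<beta>" "\<beta> \<le> \<alpha>" "\<beta> \<le> s" using f t by (auto simp: \<beta>_def)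
  have A: "0 < A" "Ct \<le> A" "Cf * 2 powr s \<le> A" "(1 / r) powr \<beta> \<le> A"
    using f t r by (auto simp: A_def intro!: add_pos_nonneg)
  have bm: "ball x a \<in> sets \<mu>" for x a using borel by simp
  have "measure \<mu> (ball x b) \<le> measure \<mu> (ball x a) + A * (b - a) powr \<beta>"
    if ab: "a \<le> b" "a \<le> r" for x a b
  proof -
    consider "a = b" | "b \<le> 0" | "r \<le> b - a" | "0 < b - a" "b - a < r" "b - a \<le> a"
      | "0 < b" "b - a < r" "a < b - a" using ab by linarith
    then show ?thesis
    proof cases
      case 1
      then show ?thesis using A by simp
    next
      case 2
      then have "measure \<mu> (ball x b) = 0" by (simp add: ball_empty)
      then show ?thesis using A by simp
    next
      case 3
      have "1 = (1 / r) powr \<beta> * r powr \<beta>" using r by (simp add: powr_divide)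
      also have "\<dots> \<le> A * (b - a) powr \<beta>" using 3 r A \<beta> by (intro mult_mono powr_mono2) auto
      finally show ?thesis using prob_le_1[of "ball x b"] measure_nonneg[of \<mu> "ball x a"] by linarith
    next
      case 4
      then have "measure \<mu> (ball x b - ball x a) \<le> Ct * (b - a) powr \<alpha>"
        using t(4)[of "b - a" a x] ab r by simp
      also have "\<dots> \<le> A * (b - a) powr \<beta>"
        using 4 r A \<beta> t by (intro mult_mono powr_mono') auto
      finally have "measure \<mu> (ball x b - ball x a) \<le> A * (b - a) powr \<beta>" .
      moreover have "measure \<mu> (ball x b - ball x a) = measure \<mu> (ball x b) - measure \<mu> (ball x a)"
        using ab bm by (intro finite_measure_Diff) (auto simp: subset_ball)
      ultimately show ?thesis by simp
    next
      case 5
      then have "measure \<mu> (ball x b) \<le> Cf * b powr s" using rf(2)[of b x] ab r by simp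
      also have "\<dots> \<le> Cf * (2 * (b - a)) powr s" using 5 f by (intro mult_left_mono powr_mono2) auto
      also have "\<dots> = Cf * 2 powr s * (b - a) powr s"
        using 5 powr_mult[of 2 "b - a" s] by (simp only: mult.assoc)
      also have "\<dots> \<le> A * (b - a) powr \<beta>"
        using 5 r A \<beta> f by (intro mult_mono powr_mono') auto
      finally show ?thesis using measure_nonneg[of \<mu> "ball x a"] by linarith
    qed
  qed
  then show ?thesis using that A(1) \<beta>(1) r(1) by blast
qed

section \<open>Decorrelation summed over the cells of a partition\<close>

text \<open>
  The quantitative consequences of the assumptions on which the estimates rest, with all constants
  fixed: polynomial covering numbers, Hoelder continuity of ball masses for radii up to \<open>r0\<close>, and the
  two forms of exponential decorrelation.
\<close>

locale mixing_system = metric_mps \<mu> T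
  for \<mu> :: "'a::metric_space measure" and T :: "'a \<Rightarrow> 'a" +
  fixes K D A \<beta> r0 C \<tau> \<sigma> :: real
  assumes pos: "0 \<le> D" "0 < A" "0 < \<beta>" "0 < r0" "0 < C" "0 < \<tau>"
    and covering: "\<And>\<rho>. 0 < \<rho> \<Longrightarrow> \<rho> \<le> 1 \<Longrightarrow>
      \<exists>F. finite F \<and> real (card F) \<le> K * \<rho> powr - D \<and> (UNIV :: 'a set) \<subseteq> (\<Union>x\<in>F. ball x \<rho>)"
    and modulus: "\<And>x a b. a \<le> b \<Longrightarrow> a \<le> r0 \<Longrightarrow>
      measure \<mu> (ball x b) \<le> measure \<mu> (ball x a) + A * (b - a) powr \<beta>"
    and mixing2: "\<And>\<phi>1 \<phi>2 n. nonneg_lipschitz \<phi>1 \<Longrightarrow> nonneg_lipschitz \<phi>2 \<Longrightarrow> 0 < n \<Longrightarrow>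
      \<bar>(\<integral>x. \<phi>1 x * \<phi>2 ((T ^^ n) x) \<partial>\<mu>) - (\<integral>x. \<phi>1 x \<partial>\<mu>) * (\<integral>x. \<phi>2 x \<partial>\<mu>)\<bar>
        \<le> C * lip_norm \<phi>1 * lip_norm \<phi>2 * exp (- \<tau> * real n)"
    and mixing3: "\<And>\<phi>1 \<phi>2 \<phi>3 k l. nonneg_lipschitz \<phi>1 \<Longrightarrow> nonneg_lipschitz \<phi>2 \<Longrightarrow>
      nonneg_lipschitz \<phi>3 \<Longrightarrow> 0 < k \<Longrightarrow> 0 < l \<Longrightarrow> real k \<le> \<sigma> * real l \<Longrightarrow>
      \<bar>(\<integral>x. \<phi>1 x * \<phi>2 ((T ^^ k) x) * \<phi>3 ((T ^^ (k + l)) x) \<partial>\<mu>)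
          - (\<integral>x. \<phi>1 x * \<phi>2 ((T ^^ k) x) \<partial>\<mu>) * (\<integral>x. \<phi>3 x \<partial>\<mu>)\<bar>
        \<le> C * lip_norm \<phi>1 * lip_norm \<phi>2 * lip_norm \<phi>3 * exp (- \<tau> * real l)"
begin

text \<open>
  The total decorrelation error over a partition of scale \<open>\<rho>\<close>: at most \<open>K * \<rho> powr - D\<close> cells, and for each of
  them at most three test functions of Lipschitz norm at most \<open>3/\<rho>\<close>.
\<close>

definition mixing_error :: "real \<Rightarrow> nat \<Rightarrow> real" where
  "mixing_error \<rho> n = 27 * C * K * \<rho> powr - (D + 3) * exp (- \<tau> * real n)"

definition return_set :: "('a \<Rightarrow> real) \<Rightarrow> nat \<Rightarrow> real \<Rightarrow> 'a set" where
  "return_set R n \<delta> = {x. dist x ((T ^^ n) x) < R x + \<delta>}"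

lemma space_UNIV [simp]: "space \<mu> = UNIV"
  using sets_eq_imp_space_eq[OF sets_borel] by simp

lemma iterate_measurable [measurable]: "T ^^ n \<in> measurable \<mu> \<mu>"
  using T_measurable by (rule measurable_compose_n)

lemma lipschitz_measurable:
  assumes "L-lipschitz_on UNIV (f :: 'a \<Rightarrow> 'b::metric_space)"
  shows "f \<in> borel_measurable \<mu>"
proof -
  have "f \<in> borel_measurable borel"
    using lipschitz_on_continuous_on[OF assms] by (rule borel_measurable_continuous_onI)
  then show ?thesis using sets_borel by (simp cong: measurable_cong_sets)
qed

lemma test_function_measurable: "\<phi> \<in> test_functions \<rho> \<Longrightarrow> \<phi> \<in> borel_measurable \<mu>"
  unfolding test_functions_def using lipschitz_measurable by blast

lemma bounded_integrable:
  fixes f :: "'a \<Rightarrow> real"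
  assumes "f \<in> borel_measurable \<mu>" "\<And>x. 0 \<le> f x" "\<And>x. f x \<le> 1"
  shows "integrable \<mu> f"
  by (rule integrable_const_bound[of _ 1]) (use assms in auto)

lemma integrable_test_products:
  assumes "\<phi>1 \<in> test_functions \<rho>" "\<phi>2 \<in> test_functions \<rho>" "\<phi>3 \<in> test_functions \<rho>"
  shows "integrable \<mu> \<phi>1" "integrable \<mu> (\<lambda>x. \<phi>1 x * \<phi>2 ((T ^^ k) x))"
    "integrable \<mu> (\<lambda>x. \<phi>1 x * \<phi>2 ((T ^^ k) x) * \<phi>3 ((T ^^ m) x))"
proof -
  note [measurable] = assms[THEN test_function_measurable]
  note b = assms[THEN test_functionD(1)] assms[THEN test_functionD(2)]
  show "integrable \<mu> \<phi>1" by (rule bounded_integrable) (use b in auto)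
  show "integrable \<mu> (\<lambda>x. \<phi>1 x * \<phi>2 ((T ^^ k) x))"
    by (rule bounded_integrable, measurable) (use b in \<open>auto intro!: mult_le_one\<close>)
  show "integrable \<mu> (\<lambda>x. \<phi>1 x * \<phi>2 ((T ^^ k) x) * \<phi>3 ((T ^^ m) x))"
    by (rule bounded_integrable, measurable) (use b in \<open>auto intro!: mult_le_one mult_nonneg_nonneg\<close>)
qed

lemma partition_at_scale:
  assumes "0 < \<rho>" "\<rho> \<le> 1"
  obtains F :: "'a set" and \<psi> where "finite F" "real (card F) \<le> K * \<rho> powr - D"
    "\<And>y. \<psi> y \<in> test_functions \<rho>" "\<And>x. (\<Sum>y\<in>F. \<psi> y x) = 1"
    "\<And>x y. y \<in> F \<Longrightarrow> \<psi> y x \<noteq> 0 \<Longrightarrow> dist y x < 2 * \<rho>"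
proof -
  obtain F :: "'a set" where F: "finite F" "real (card F) \<le> K * \<rho> powr - D" "UNIV \<subseteq> (\<Union>y\<in>F. ball y \<rho>)"
    using covering[OF assms] by blast
  show ?thesis
    by (rule lipschitz_partition_of_unity[OF assms(1) F(1,3)]) (rule that[OF F(1,2)])
qed

lemma cells_mixing2:
  assumes \<rho>: "0 < \<rho>" "\<rho> \<le> 1" and n: "0 < n"
    and F: "real (card F) \<le> K * \<rho> powr - D"
    and \<psi>: "\<And>y. \<psi> y \<in> test_functions \<rho>" and f: "\<And>y. f y \<in> test_functions \<rho>"
  shows "\<bar>(\<Sum>y\<in>F. \<integral>x. \<psi> y x * f y ((T ^^ n) x) \<partial>\<mu>) - (\<Sum>y\<in>F. (\<integral>x. \<psi> y x \<partial>\<mu>) * (\<integral>x. f y x \<partial>\<mu>))\<bar>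
    \<le> mixing_error \<rho> n"
proof -
  have "\<bar>(\<Sum>y\<in>F. \<integral>x. \<psi> y x * f y ((T ^^ n) x) \<partial>\<mu>) - (\<Sum>y\<in>F. (\<integral>x. \<psi> y x \<partial>\<mu>) * (\<integral>x. f y x \<partial>\<mu>))\<bar>
      \<le> (\<Sum>y\<in>F. \<bar>(\<integral>x. \<psi> y x * f y ((T ^^ n) x) \<partial>\<mu>) - (\<integral>x. \<psi> y x \<partial>\<mu>) * (\<integral>x. f y x \<partial>\<mu>)\<bar>)"
    unfolding sum_subtractf[symmetric] by (rule sum_abs)
  also have "\<dots> \<le> (\<Sum>y\<in>F. 27 * C * \<rho> powr - 3 * exp (- \<tau> * real n))"
  proof (rule sum_mono)
    fix y
    note l = test_function_lip_norm[OF \<psi> \<rho>, of y] test_function_lip_norm[OF f \<rho>, of y]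
    have "\<bar>(\<integral>x. \<psi> y x * f y ((T ^^ n) x) \<partial>\<mu>) - (\<integral>x. \<psi> y x \<partial>\<mu>) * (\<integral>x. f y x \<partial>\<mu>)\<bar>
        \<le> C * lip_norm (\<psi> y) * lip_norm (f y) * exp (- \<tau> * real n)"
      by (rule mixing2[OF test_functionD(3)[OF \<psi>] test_functionD(3)[OF f] n])
    also have "\<dots> \<le> C * (3 / \<rho>) * (3 / \<rho>) * exp (- \<tau> * real n)"
      using l pos \<rho> by (intro mult_mono mult_right_mono mult_left_mono) auto
    \<comment> \<open>A factor is given away so that two and three test functions lead to the same error term.\<close>
    also have "\<dots> \<le> C * (3 / \<rho>) * (3 / \<rho>) * exp (- \<tau> * real n) * (3 / \<rho>)"
    proof -
      have "1 \<le> 3 / \<rho>" using \<rho> by simp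
      from mult_left_mono[OF this, of "C * (3 / \<rho>) * (3 / \<rho>) * exp (- \<tau> * real n)"]
      show ?thesis using pos \<rho> by simp
    qed
    also have "\<dots> = 27 * C * \<rho> powr - 3 * exp (- \<tau> * real n)"
      using \<rho> by (simp add: powr_minus powr_numeral power3_eq_cube field_simps)
    finally show "\<bar>(\<integral>x. \<psi> y x * f y ((T ^^ n) x) \<partial>\<mu>) - (\<integral>x. \<psi> y x \<partial>\<mu>) * (\<integral>x. f y x \<partial>\<mu>)\<bar>
        \<le> 27 * C * \<rho> powr - 3 * exp (- \<tau> * real n)" .
  qed
  also have "\<dots> = real (card F) * (27 * C * \<rho> powr - 3 * exp (- \<tau> * real n))" by simp
  also have "\<dots> \<le> K * \<rho> powr - D * (27 * C * \<rho> powr - 3 * exp (- \<tau> * real n))"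
    using F pos by (intro mult_right_mono) auto
  also have "\<dots> = mixing_error \<rho> n"
    unfolding mixing_error_def by (simp add: powr_add[symmetric] powr_diff powr_minus field_simps)
  finally show ?thesis .
qed

lemma cells_mixing3:
  assumes \<rho>: "0 < \<rho>" "\<rho> \<le> 1" and kl: "0 < k" "0 < l" "real k \<le> \<sigma> * real l"
    and F: "real (card F) \<le> K * \<rho> powr - D"
    and \<psi>: "\<And>y. \<psi> y \<in> test_functions \<rho>" and f: "\<And>y. f y \<in> test_functions \<rho>"
    and h: "\<And>y. h y \<in> test_functions \<rho>"
  shows "(\<Sum>y\<in>F. \<integral>x. \<psi> y x * f y ((T ^^ k) x) * h y ((T ^^ (k + l)) x) \<partial>\<mu>)
    \<le> (\<Sum>y\<in>F. (\<integral>x. \<psi> y x * f y ((T ^^ k) x) \<partial>\<mu>) * (\<integral>x. h y x \<partial>\<mu>)) + mixing_error \<rho> l"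
proof -
  have "(\<Sum>y\<in>F. \<integral>x. \<psi> y x * f y ((T ^^ k) x) * h y ((T ^^ (k + l)) x) \<partial>\<mu>)
     \<le> (\<Sum>y\<in>F. (\<integral>x. \<psi> y x * f y ((T ^^ k) x) \<partial>\<mu>) * (\<integral>x. h y x \<partial>\<mu>)
          + 27 * C * \<rho> powr - 3 * exp (- \<tau> * real l))"
  proof (rule sum_mono)
    fix y
    note n = test_function_lip_norm[OF \<psi> \<rho>, of y] test_function_lip_norm[OF f \<rho>, of y]
      test_function_lip_norm[OF h \<rho>, of y]
    have "(\<integral>x. \<psi> y x * f y ((T ^^ k) x) * h y ((T ^^ (k + l)) x) \<partial>\<mu>)
         - (\<integral>x. \<psi> y x * f y ((T ^^ k) x) \<partial>\<mu>) * (\<integral>x. h y x \<partial>\<mu>)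
        \<le> C * lip_norm (\<psi> y) * lip_norm (f y) * lip_norm (h y) * exp (- \<tau> * real l)"
      using mixing3[OF test_functionD(3)[OF \<psi>] test_functionD(3)[OF f] test_functionD(3)[OF h] kl,
          of y y y] by linarith
    also have "\<dots> \<le> C * (3 / \<rho>) * (3 / \<rho>) * (3 / \<rho>) * exp (- \<tau> * real l)"
      using n pos \<rho> by (intro mult_mono mult_right_mono mult_left_mono) auto
    also have "\<dots> = 27 * C * \<rho> powr - 3 * exp (- \<tau> * real l)"
      using \<rho> by (simp add: powr_minus powr_numeral power3_eq_cube field_simps)
    finally show "(\<integral>x. \<psi> y x * f y ((T ^^ k) x) * h y ((T ^^ (k + l)) x) \<partial>\<mu>)
      \<le> (\<integral>x. \<psi> y x * f y ((T ^^ k) x) \<partial>\<mu>) * (\<integral>x. h y x \<partial>\<mu>)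
          + 27 * C * \<rho> powr - 3 * exp (- \<tau> * real l)" by simp
  qed
  also have "\<dots> = (\<Sum>y\<in>F. (\<integral>x. \<psi> y x * f y ((T ^^ k) x) \<partial>\<mu>) * (\<integral>x. h y x \<partial>\<mu>))
      + real (card F) * (27 * C * \<rho> powr - 3 * exp (- \<tau> * real l))"
    by (simp add: sum.distrib)
  also have "real (card F) * (27 * C * \<rho> powr - 3 * exp (- \<tau> * real l))
      \<le> K * \<rho> powr - D * (27 * C * \<rho> powr - 3 * exp (- \<tau> * real l))"
    using F pos by (intro mult_right_mono) auto
  also have "\<dots> = mixing_error \<rho> l"
    unfolding mixing_error_def by (simp add: powr_add[symmetric] powr_diff powr_minus field_simps)
  finally show ?thesis by simp
qed

lemma cell_sum_integrals:
  assumes "finite F" "\<And>y. \<psi> y \<in> test_functions \<rho>" "\<And>x. (\<Sum>y\<in>F. \<psi> y x) = 1"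
  shows "(\<Sum>y\<in>F. \<integral>x. \<psi> y x \<partial>\<mu>) = 1"
proof -
  have "(\<Sum>y\<in>F. \<integral>x. \<psi> y x \<partial>\<mu>) = (\<integral>x. (\<Sum>y\<in>F. \<psi> y x) \<partial>\<mu>)"
    using assms(2) by (intro Bochner_Integration.integral_sum[symmetric] integrable_test_products) auto
  then show ?thesis using assms(3) prob_space by simp
qed

section \<open>Radii of balls of prescribed mass\<close>

lemma bounded_UNIV: "bounded (UNIV :: 'a set)"
proof -
  obtain F :: "'a set" where "finite F" "UNIV \<subseteq> (\<Union>x\<in>F. ball x 1)"
    using covering[of 1] by auto
  then show ?thesis by (meson bounded_UN bounded_ball bounded_subset)
qed

lemma mass_radius_set_nonempty:
  assumes "m \<le> 1"
  shows "{r. 0 \<le> r \<and> m \<le> measure \<mu> (ball x r)} \<noteq> {}"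
proof -
  obtain e where "\<And>y. dist x y \<le> e"
    using bounded_UNIV bounded_any_center[of UNIV x] by auto
  then have "ball x (\<bar>e\<bar> + 1) = space \<mu>" by (auto simp: ball_def) (smt (verit))
  then have "measure \<mu> (ball x (\<bar>e\<bar> + 1)) = 1" using prob_space by simp
  then have "\<bar>e\<bar> + 1 \<in> {r. 0 \<le> r \<and> m \<le> measure \<mu> (ball x r)}" using assms by simp
  then show ?thesis by blast
qed

lemma mass_radius_le:
  assumes "0 \<le> r" "m \<le> measure \<mu> (ball x r)"
  shows "mass_radius \<mu> m x \<le> r"
  unfolding mass_radius_def by (rule cInf_lower) (use assms in \<open>auto intro: bdd_belowI[of _ 0]\<close>)

lemma mass_radius_approx:
  assumes "m \<le> 1" "mass_radius \<mu> m x < b"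
  obtains r where "0 \<le> r" "m \<le> measure \<mu> (ball x r)" "r < b"
  using cInf_lessD[OF mass_radius_set_nonempty[OF assms(1)], of x b] assms(2)
  unfolding mass_radius_def by auto

text \<open>
  A ball about \<open>y\<close> is contained in the ball about \<open>x\<close> whose radius is larger by \<open>dist x y\<close>.
\<close>

lemma mass_radius_lipschitz:
  assumes "m \<le> 1"
  shows "1-lipschitz_on UNIV (mass_radius \<mu> m)"
proof (rule lipschitz_onI)
  have *: "mass_radius \<mu> m x \<le> mass_radius \<mu> m y + dist x y" for x y
  proof (rule field_le_epsilon)
    fix e :: real assume "0 < e"
    then obtain r where r: "0 \<le> r" "m \<le> measure \<mu> (ball y r)" "r < mass_radius \<mu> m y + e"
      using mass_radius_approx[OF assms, of y "mass_radius \<mu> m y + e"] by auto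
    have "ball y r \<subseteq> ball x (r + dist x y)"
    proof
      fix z assume "z \<in> ball y r"
      then show "z \<in> ball x (r + dist x y)" using dist_triangle[of x z y] by simp
    qed
    then have "measure \<mu> (ball y r) \<le> measure \<mu> (ball x (r + dist x y))"
      by (intro finite_measure_mono) (auto simp: sets_borel)
    then have "mass_radius \<mu> m x \<le> r + dist x y" using r by (intro mass_radius_le) auto
    then show "mass_radius \<mu> m x \<le> mass_radius \<mu> m y + dist x y + e" using r by simp
  qed
  show "dist (mass_radius \<mu> m x) (mass_radius \<mu> m y) \<le> 1 * dist x y" for x y
    using *[of x y] *[of y x] by (simp add: dist_real_def dist_commute abs_le_iff)
qed simp

text \<open>
  At a radius slightly below the infimum the mass is at most \<open>m\<close>; Hoelder continuity carries this to a
  radius slightly above it.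
\<close>

lemma ball_mass_upper:
  assumes m: "0 \<le> m" and small: "mass_radius \<mu> m x \<le> r0" and \<delta>: "0 < \<delta>"
  shows "measure \<mu> (ball x (mass_radius \<mu> m x + \<delta>)) \<le> m + A * (2 * \<delta>) powr \<beta>"
proof -
  let ?a = "mass_radius \<mu> m x - \<delta>"
  have "measure \<mu> (ball x ?a) \<le> m"
  proof (cases "0 \<le> ?a")
    case True
    then show ?thesis using mass_radius_le[OF True, of m x] \<delta> by linarith
  next
    case False
    then show ?thesis using m by (simp add: ball_empty)
  qed
  moreover have "measure \<mu> (ball x (mass_radius \<mu> m x + \<delta>))
      \<le> measure \<mu> (ball x ?a) + A * (2 * \<delta>) powr \<beta>"
  proof -
    have "mass_radius \<mu> m x + \<delta> - ?a = 2 * \<delta>" by simp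
    then show ?thesis using modulus[of ?a "mass_radius \<mu> m x + \<delta>" x] small \<delta> by fastforce
  qed
  ultimately show ?thesis by simp
qed

lemma ball_mass_lower:
  assumes m: "m \<le> 1" and small: "mass_radius \<mu> m x \<le> r0" and \<delta>: "0 < \<delta>"
  shows "m - A * (2 * \<delta>) powr \<beta> \<le> measure \<mu> (ball x (mass_radius \<mu> m x - \<delta>))"
proof -
  let ?a = "mass_radius \<mu> m x - \<delta>"
  obtain r where r: "0 \<le> r" "m \<le> measure \<mu> (ball x r)" "r < mass_radius \<mu> m x + \<delta>"
    using mass_radius_approx[OF m, of x "mass_radius \<mu> m x + \<delta>"] \<delta> by auto
  have "mass_radius \<mu> m x \<le> r" using r by (intro mass_radius_le)
  then have "measure \<mu> (ball x r) \<le> measure \<mu> (ball x ?a) + A * (r - ?a) powr \<beta>"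
    using small \<delta> by (intro modulus) auto
  also have "A * (r - ?a) powr \<beta> \<le> A * (2 * \<delta>) powr \<beta>"
    using pos r \<open>mass_radius \<mu> m x \<le> r\<close> \<delta> by (intro mult_left_mono powr_mono2) auto
  finally show ?thesis using r by simp
qed

text \<open>
  Finitely many balls of half the radius cover the space. Those of measure 0 may be discarded, and
  every point of another one is the centre of a ball of radius \<open>r\<close> that contains it. This is why
  small masses have small radii almost everywhere.
\<close>

lemma AE_ball_mass_bounded_below:
  assumes "0 < r"
  obtains m0 where "0 < m0" "AE x in \<mu>. m0 \<le> measure \<mu> (ball x r)"
proof -
  define \<rho> where "\<rho> = min 1 (r / 2)"
  have \<rho>: "0 < \<rho>" "\<rho> \<le> 1" "2 * \<rho> \<le> r" using assms by (auto simp: \<rho>_def)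
  obtain F :: "'a set" where F: "finite F" "UNIV \<subseteq> (\<Union>y\<in>F. ball y \<rho>)"
    using covering[OF \<rho>(1,2)] by auto
  define P where "P = {y \<in> F. 0 < measure \<mu> (ball y \<rho>)}"
  define m0 where "m0 = Min (insert 1 ((\<lambda>y. measure \<mu> (ball y \<rho>)) ` P))"
  have m0: "0 < m0" "\<And>y. y \<in> P \<Longrightarrow> m0 \<le> measure \<mu> (ball y \<rho>)"
    using F(1) by (auto simp: m0_def P_def)
  have "(\<Union>y\<in>F - P. ball y \<rho>) \<in> null_sets \<mu>"
  proof (intro null_sets_UN' countable_finite)
    fix y assume "y \<in> F - P"
    then have "measure \<mu> (ball y \<rho>) = 0" unfolding P_def using measure_nonneg[of \<mu> "ball y \<rho>"] by auto
    then show "ball y \<rho> \<in> null_sets \<mu>" by (simp add: null_sets_def sets_borel emeasure_eq_measure)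
  qed (use F in simp)
  then have "AE x in \<mu>. m0 \<le> measure \<mu> (ball x r)"
  proof (rule AE_I', intro subsetI)
    fix x assume x: "x \<in> {x \<in> space \<mu>. \<not> m0 \<le> measure \<mu> (ball x r)}"
    obtain y where y: "y \<in> F" "x \<in> ball y \<rho>" using F(2) by blast
    have "y \<notin> P"
    proof
      assume "y \<in> P"
      have "ball y \<rho> \<subseteq> ball x r"
      proof
        fix z assume "z \<in> ball y \<rho>"
        then show "z \<in> ball x r" using y(2) \<rho>(3) dist_triangle[of x z y] by (simp add: dist_commute)
      qed
      then have "measure \<mu> (ball y \<rho>) \<le> measure \<mu> (ball x r)"
        by (intro finite_measure_mono) (auto simp: sets_borel)
      then show False using m0(2)[OF \<open>y \<in> P\<close>] x by simp
    qed
    then show "x \<in> (\<Union>y\<in>F - P. ball y \<rho>)" using y by blast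
  qed
  then show ?thesis using that m0(1) by blast
qed

text \<open>
  Where the radius is large at a centre \<open>y\<close>, Hoelder continuity of ball masses is not available. Such
  cells carry no mass: the radius is small almost everywhere and is 1-Lipschitz.
\<close>

lemma cell_integral_eq_0:
  assumes m: "m \<le> 1" and small: "AE x in \<mu>. mass_radius \<mu> m x \<le> r0 / 2"
    and \<rho>: "\<rho> \<le> r0 / 4" and large: "r0 < mass_radius \<mu> m y"
    and supp: "\<And>x. \<psi> x \<noteq> 0 \<Longrightarrow> dist y x < 2 * \<rho>"
  shows "(\<integral>x. \<psi> x * f x \<partial>\<mu>) = (0::real)"
proof -
  have "AE x in \<mu>. \<psi> x * f x = 0"
    using small
  proof eventually_elim
    case (elim x)
    have "dist (mass_radius \<mu> m y) (mass_radius \<mu> m x) \<le> dist y x"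
      using lipschitz_onD[OF mass_radius_lipschitz[OF m], of y x] by simp
    then have "\<not> dist y x < 2 * \<rho>" using elim large \<rho> by (simp add: dist_real_def)
    then show ?case using supp by auto
  qed
  then show ?thesis by (rule integral_eq_zero_AE)
qed

section \<open>Measure of the sets of returning points\<close>

lemma countable_dense_set:
  obtains Z :: "'a set" where "countable Z" "\<And>x e. 0 < e \<Longrightarrow> \<exists>z\<in>Z. dist z x < e"
proof -
  have "\<forall>j::nat. \<exists>F :: 'a set. finite F \<and> UNIV \<subseteq> (\<Union>y\<in>F. ball y (inverse (real (Suc j))))"
  proof
    fix j :: nat
    show "\<exists>F :: 'a set. finite F \<and> UNIV \<subseteq> (\<Union>y\<in>F. ball y (inverse (real (Suc j))))"
      using covering[of "inverse (real (Suc j))"] by (auto simp: inverse_le_1_iff)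
  qed
  then obtain F :: "nat \<Rightarrow> 'a set" where
    F: "\<And>j. finite (F j)" "\<And>j. UNIV \<subseteq> (\<Union>y\<in>F j. ball y (inverse (real (Suc j))))"
    by metis
  have "\<exists>z\<in>(\<Union>j. F j). dist z x < e" if e: "0 < e" for x e
  proof -
    obtain j :: nat where "inverse (real (Suc j)) < e" using reals_Archimedean[OF e] by blast
    moreover obtain z where "z \<in> F j" "dist z x < inverse (real (Suc j))"
      using F(2)[of j] by fastforce
    ultimately show ?thesis by force
  qed
  moreover have "countable (\<Union>j. F j)" using F(1) by (auto intro: countable_finite)
  ultimately show ?thesis using that by blast
qed

text \<open>
  On a metric space without a countability assumption the distance need not be jointly Borel, but here
  the covering property gives a countable dense set, and \<open>dist x (T\<^sup>n x)\<close> is the infimum of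
  \<open>dist x z + dist z (T\<^sup>n x)\<close> over such points \<open>z\<close>.
\<close>

lemma return_set_sets:
  assumes R: "1-lipschitz_on UNIV R"
  shows "return_set R n \<delta> \<in> sets \<mu>"
proof -
  obtain Z :: "'a set" where Z: "countable Z" "\<And>x e. 0 < e \<Longrightarrow> \<exists>z\<in>Z. dist z x < e"
    using countable_dense_set by blast
  have [measurable]: "R \<in> borel_measurable \<mu>" by (rule lipschitz_measurable[OF R])
  have d [measurable]: "(\<lambda>x. dist z x) \<in> borel_measurable \<mu>" for z
  proof (rule lipschitz_measurable[of 1])
    show "1-lipschitz_on UNIV (dist z)"
      by (rule lipschitz_onI) (simp_all add: dist_real_def, metis abs_dist_diff_le dist_commute)
  qed
  have [measurable]: "(\<lambda>x. dist z ((T ^^ n) x)) \<in> borel_measurable \<mu>" for z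
    using measurable_compose[OF iterate_measurable d] .
  have "return_set R n \<delta> = (\<Union>z\<in>Z. {x \<in> space \<mu>. dist z x + dist z ((T ^^ n) x) < R x + \<delta>})"
  proof (intro equalityI subsetI)
    fix x assume "x \<in> return_set R n \<delta>"
    then have "0 < (R x + \<delta> - dist x ((T ^^ n) x)) / 2" by (simp add: return_set_def)
    then obtain z where z: "z \<in> Z" "dist z x < (R x + \<delta> - dist x ((T ^^ n) x)) / 2"
      using Z(2) by blast
    have "dist z ((T ^^ n) x) \<le> dist z x + dist x ((T ^^ n) x)" by (rule dist_triangle)
    then have "dist z x + dist z ((T ^^ n) x) < R x + \<delta>" using z(2) by simp
    then show "x \<in> (\<Union>z\<in>Z. {x \<in> space \<mu>. dist z x + dist z ((T ^^ n) x) < R x + \<delta>})"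
      using z(1) by auto
  next
    fix x assume "x \<in> (\<Union>z\<in>Z. {x \<in> space \<mu>. dist z x + dist z ((T ^^ n) x) < R x + \<delta>})"
    then obtain z where "dist z x + dist z ((T ^^ n) x) < R x + \<delta>" by auto
    then show "x \<in> return_set R n \<delta>"
      using dist_triangle[of x "(T ^^ n) x" z] by (simp add: return_set_def dist_commute)
  qed
  also have "\<dots> \<in> sets \<mu>"
    by (intro sets.countable_UN'[OF Z(1)] image_subsetI) measurable
  finally show ?thesis .
qed

lemma integral_cutoff_bounds:
  assumes "0 < \<rho>"
  shows "measure \<mu> (ball y a) \<le> (\<integral>z. cutoff a \<rho> (dist y z) \<partial>\<mu>)"
    and "(\<integral>z. cutoff a \<rho> (dist y z) \<partial>\<mu>) \<le> measure \<mu> (ball y (a + \<rho>))"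
proof -
  note i = integrable_test_products(1)[OF cutoff_test_function cutoff_test_function cutoff_test_function,
      OF assms assms assms, of a y]
  have b: "integrable \<mu> (indicator (ball y r) :: 'a \<Rightarrow> real)" for r
    by (intro integrable_real_indicator) (auto simp: sets_borel less_top[symmetric])
  have "(\<integral>z. indicator (ball y a) z \<partial>\<mu>) \<le> (\<integral>z. cutoff a \<rho> (dist y z) \<partial>\<mu>)"
    using cutoff_eq_1[OF assms] cutoff_nonneg
    by (intro integral_mono b i) (auto simp: indicator_def)
  then show "measure \<mu> (ball y a) \<le> (\<integral>z. cutoff a \<rho> (dist y z) \<partial>\<mu>)" by (simp add: sets_borel)
  have "(\<integral>z. cutoff a \<rho> (dist y z) \<partial>\<mu>) \<le> (\<integral>z. indicator (ball y (a + \<rho>)) z \<partial>\<mu>)"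
    using cutoff_eq_0[OF assms] cutoff_le_1
    by (intro integral_mono b i) (auto simp: indicator_def not_less)
  then show "(\<integral>z. cutoff a \<rho> (dist y z) \<partial>\<mu>) \<le> measure \<mu> (ball y (a + \<rho>))" by (simp add: sets_borel)
qed

lemma measure_eq_integral_indicator:
  "S \<in> sets \<mu> \<Longrightarrow> measure \<mu> S = (\<integral>x. indicator S x \<partial>\<mu>)"
  "S \<in> sets \<mu> \<Longrightarrow> integrable \<mu> (indicator S :: 'a \<Rightarrow> real)"
  by (simp_all add: less_top[symmetric] integrable_real_indicator)

text \<open>
  A cell of diameter \<open>O(\<rho>)\<close> around \<open>y\<close> is tested against the ball about \<open>y\<close> whose radius is smaller than
  \<open>mass_radius \<mu> m y\<close> by \<open>5 \<rho>\<close>: two units compensate for the distance from \<open>x\<close> to \<open>y\<close>, two for the variation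
  of the radius, and one for the width of the cut-off.
\<close>

lemma return_mass_lower:
  assumes m: "0 \<le> m" "m \<le> 1" and small: "AE x in \<mu>. mass_radius \<mu> m x \<le> r0 / 2"
    and \<rho>: "0 < \<rho>" "\<rho> \<le> 1" "\<rho> \<le> r0 / 4" and n: "0 < n"
  shows "m - A * (10 * \<rho>) powr \<beta> - mixing_error \<rho> n \<le> measure \<mu> (return_set (mass_radius \<mu> m) n 0)"
proof -
  let ?R = "mass_radius \<mu> m" and ?S = "return_set (mass_radius \<mu> m) n 0"
  obtain F :: "'a set" and \<psi> where F: "finite F" "real (card F) \<le> K * \<rho> powr - D"
    and \<psi>: "\<And>y. \<psi> y \<in> test_functions \<rho>" "\<And>x. (\<Sum>y\<in>F. \<psi> y x) = 1"
    "\<And>x y. y \<in> F \<Longrightarrow> \<psi> y x \<noteq> 0 \<Longrightarrow> dist y x < 2 * \<rho>"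
    using partition_at_scale[OF \<rho>(1,2)] by blast
  define f where "f y = (\<lambda>z. cutoff (?R y - 5 * \<rho>) \<rho> (dist y z))" for y
  have f: "f y \<in> test_functions \<rho>" for y unfolding f_def by (rule cutoff_test_function[OF \<rho>(1)])
  have S: "?S \<in> sets \<mu>" by (rule return_set_sets[OF mass_radius_lipschitz[OF m(2)]])
  have int: "integrable \<mu> (\<lambda>x. \<psi> y x * f y ((T ^^ n) x))" for y
    by (rule integrable_test_products(2)[OF \<psi>(1) f f])
  have "m - A * (10 * \<rho>) powr \<beta> = (\<Sum>y\<in>F. (\<integral>x. \<psi> y x \<partial>\<mu>) * (m - A * (10 * \<rho>) powr \<beta>))"
    unfolding sum_distrib_right[symmetric] cell_sum_integrals[OF F(1) \<psi>(1,2)] by simp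
  also have "\<dots> \<le> (\<Sum>y\<in>F. (\<integral>x. \<psi> y x \<partial>\<mu>) * (\<integral>z. f y z \<partial>\<mu>))"
  proof (rule sum_mono)
    fix y assume y: "y \<in> F"
    show "(\<integral>x. \<psi> y x \<partial>\<mu>) * (m - A * (10 * \<rho>) powr \<beta>) \<le> (\<integral>x. \<psi> y x \<partial>\<mu>) * (\<integral>z. f y z \<partial>\<mu>)"
    proof (cases "?R y \<le> r0")
      case True
      have "m - A * (10 * \<rho>) powr \<beta> \<le> measure \<mu> (ball y (?R y - 5 * \<rho>))"
        using ball_mass_lower[OF m(2) True, of "5 * \<rho>"] \<rho>(1) by simp
      also have "\<dots> \<le> (\<integral>z. f y z \<partial>\<mu>)" unfolding f_def by (rule integral_cutoff_bounds[OF \<rho>(1)])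
      finally show ?thesis
        using test_functionD(1)[OF \<psi>(1)] by (intro mult_left_mono) (auto intro: integral_nonneg_AE)
    next
      case False
      then have "(\<integral>x. \<psi> y x * 1 \<partial>\<mu>) = 0"
        using \<psi>(3)[OF y] by (intro cell_integral_eq_0[OF m(2) small \<rho>(3)]) auto
      then show ?thesis by simp
    qed
  qed
  also have "\<dots> \<le> (\<Sum>y\<in>F. \<integral>x. \<psi> y x * f y ((T ^^ n) x) \<partial>\<mu>) + mixing_error \<rho> n"
    using cells_mixing2[where \<psi> = \<psi> and f = f, OF \<rho>(1,2) n F(2) \<psi>(1) f] by linarith
  also have "(\<Sum>y\<in>F. \<integral>x. \<psi> y x * f y ((T ^^ n) x) \<partial>\<mu>) = (\<integral>x. (\<Sum>y\<in>F. \<psi> y x * f y ((T ^^ n) x)) \<partial>\<mu>)"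
    using int by (intro Bochner_Integration.integral_sum[symmetric])
  also have "\<dots> \<le> (\<integral>x. indicator ?S x \<partial>\<mu>)"
  proof (intro integral_mono Bochner_Integration.integrable_sum int measure_eq_integral_indicator S)
    fix x
    show "(\<Sum>y\<in>F. \<psi> y x * f y ((T ^^ n) x)) \<le> indicator ?S x"
    proof (cases "x \<in> ?S")
      case True
      have "(\<Sum>y\<in>F. \<psi> y x * f y ((T ^^ n) x)) \<le> (\<Sum>y\<in>F. \<psi> y x)"
        using test_functionD[OF \<psi>(1)] test_functionD[OF f] by (intro sum_mono mult_left_le) auto
      then show ?thesis using True \<psi>(2) by simp
    next
      case False
      have "\<psi> y x * f y ((T ^^ n) x) = 0" if y: "y \<in> F" for y
      proof (rule ccontr)
        assume nz: "\<psi> y x * f y ((T ^^ n) x) \<noteq> 0"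
        then have 1: "dist y x < 2 * \<rho>" using \<psi>(3)[OF y] by simp
        have 2: "dist y ((T ^^ n) x) < ?R y - 4 * \<rho>"
          using nz cutoff_eq_0[OF \<rho>(1), of "?R y - 5 * \<rho>" "dist y ((T ^^ n) x)"]
          by (force simp: f_def)
        have "dist x ((T ^^ n) x) < ?R x"
          using 1 2 dist_triangle[of x "(T ^^ n) x" y]
            lipschitz_onD[OF mass_radius_lipschitz[OF m(2)], of y x]
          by (simp add: dist_real_def dist_commute)
        then show False using False by (simp add: return_set_def)
      qed
      then have "(\<Sum>y\<in>F. \<psi> y x * f y ((T ^^ n) x)) = 0" by (intro sum.neutral) blast
      then show ?thesis by simp
    qed
  qed
  also have "\<dots> = measure \<mu> ?S" by (rule measure_eq_integral_indicator(1)[OF S, symmetric])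
  finally show ?thesis by simp
qed

text \<open>
  The same argument with enlarged balls. The extra \<open>\<delta>\<close> is used for the neighbourhood of the
  recurrence set that appears in the estimate of two recurrences.
\<close>

lemma return_mass_upper:
  assumes m: "0 \<le> m" "m \<le> 1" and small: "AE x in \<mu>. mass_radius \<mu> m x \<le> r0 / 2"
    and \<rho>: "0 < \<rho>" "\<rho> \<le> 1" "\<rho> \<le> r0 / 4" and n: "0 < n" and \<delta>: "0 \<le> \<delta>"
  shows "measure \<mu> (return_set (mass_radius \<mu> m) n \<delta>)
    \<le> m + A * (2 * (5 * \<rho> + \<delta>)) powr \<beta> + mixing_error \<rho> n"
proof -
  let ?R = "mass_radius \<mu> m" and ?S = "return_set (mass_radius \<mu> m) n \<delta>"
  let ?B = "m + A * (2 * (5 * \<rho> + \<delta>)) powr \<beta>"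
  obtain F :: "'a set" and \<psi> where F: "finite F" "real (card F) \<le> K * \<rho> powr - D"
    and \<psi>: "\<And>y. \<psi> y \<in> test_functions \<rho>" "\<And>x. (\<Sum>y\<in>F. \<psi> y x) = 1"
    "\<And>x y. y \<in> F \<Longrightarrow> \<psi> y x \<noteq> 0 \<Longrightarrow> dist y x < 2 * \<rho>"
    using partition_at_scale[OF \<rho>(1,2)] by blast
  define f where "f y = (\<lambda>z. cutoff (?R y + (4 * \<rho> + \<delta>)) \<rho> (dist y z))" for y
  have f: "f y \<in> test_functions \<rho>" for y unfolding f_def by (rule cutoff_test_function[OF \<rho>(1)])
  have S: "?S \<in> sets \<mu>" by (rule return_set_sets[OF mass_radius_lipschitz[OF m(2)]])
  have int: "integrable \<mu> (\<lambda>x. \<psi> y x * f y ((T ^^ n) x))" for y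
    by (rule integrable_test_products(2)[OF \<psi>(1) f f])
  have "measure \<mu> ?S = (\<integral>x. indicator ?S x \<partial>\<mu>)" by (rule measure_eq_integral_indicator(1)[OF S])
  also have "\<dots> \<le> (\<integral>x. (\<Sum>y\<in>F. \<psi> y x * f y ((T ^^ n) x)) \<partial>\<mu>)"
  proof (intro integral_mono Bochner_Integration.integrable_sum int measure_eq_integral_indicator S)
    fix x
    show "indicator ?S x \<le> (\<Sum>y\<in>F. \<psi> y x * f y ((T ^^ n) x))"
    proof (cases "x \<in> ?S")
      case True
      have "\<psi> y x = \<psi> y x * f y ((T ^^ n) x)" if y: "y \<in> F" for y
      proof (cases "\<psi> y x = 0")
        case False
        then have "dist y x < 2 * \<rho>" using \<psi>(3)[OF y] by simp
        then have "dist y ((T ^^ n) x) \<le> ?R y + (4 * \<rho> + \<delta>)"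
          using True dist_triangle[of y "(T ^^ n) x" x]
            lipschitz_onD[OF mass_radius_lipschitz[OF m(2)], of y x]
          by (simp add: dist_real_def return_set_def)
        then show ?thesis by (simp add: f_def cutoff_eq_1[OF \<rho>(1)])
      qed simp
      then have "(\<Sum>y\<in>F. \<psi> y x) = (\<Sum>y\<in>F. \<psi> y x * f y ((T ^^ n) x))" by (rule sum.cong[OF refl])
      then show ?thesis using True \<psi>(2) by simp
    next
      case False
      then show ?thesis using test_functionD[OF \<psi>(1)] test_functionD[OF f] by (auto intro!: sum_nonneg)
    qed
  qed
  also have "\<dots> = (\<Sum>y\<in>F. \<integral>x. \<psi> y x * f y ((T ^^ n) x) \<partial>\<mu>)"
    using int by (intro Bochner_Integration.integral_sum)
  also have "\<dots> \<le> (\<Sum>y\<in>F. (\<integral>x. \<psi> y x \<partial>\<mu>) * (\<integral>z. f y z \<partial>\<mu>)) + mixing_error \<rho> n"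
    using cells_mixing2[where \<psi> = \<psi> and f = f, OF \<rho>(1,2) n F(2) \<psi>(1) f] by linarith
  also have "(\<Sum>y\<in>F. (\<integral>x. \<psi> y x \<partial>\<mu>) * (\<integral>z. f y z \<partial>\<mu>)) \<le> (\<Sum>y\<in>F. (\<integral>x. \<psi> y x \<partial>\<mu>) * ?B)"
  proof (rule sum_mono)
    fix y assume y: "y \<in> F"
    show "(\<integral>x. \<psi> y x \<partial>\<mu>) * (\<integral>z. f y z \<partial>\<mu>) \<le> (\<integral>x. \<psi> y x \<partial>\<mu>) * ?B"
    proof (cases "?R y \<le> r0")
      case True
      have "(\<integral>z. f y z \<partial>\<mu>) \<le> measure \<mu> (ball y (?R y + (4 * \<rho> + \<delta>) + \<rho>))"
        unfolding f_def by (rule integral_cutoff_bounds[OF \<rho>(1)])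
      also have "?R y + (4 * \<rho> + \<delta>) + \<rho> = ?R y + (5 * \<rho> + \<delta>)" by simp
      also have "measure \<mu> (ball y (?R y + (5 * \<rho> + \<delta>))) \<le> ?B"
        using \<rho>(1) \<delta> by (intro ball_mass_upper[OF m(1) True]) simp
      finally show ?thesis
        using test_functionD(1)[OF \<psi>(1)] by (intro mult_left_mono) (auto intro: integral_nonneg_AE)
    next
      case False
      then have "(\<integral>x. \<psi> y x * 1 \<partial>\<mu>) = 0"
        using \<psi>(3)[OF y] by (intro cell_integral_eq_0[OF m(2) small \<rho>(3)]) auto
      then show ?thesis by simp
    qed
  qed
  also have "\<dots> = ?B"
    unfolding sum_distrib_right[symmetric] cell_sum_integrals[OF F(1) \<psi>(1,2)] by simp
  finally show ?thesis by simp
qed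

text \<open>
  Threefold decorrelation splits off the factor at time \<open>k + l\<close> in each cell; that factor is almost \<open>m\<close>,
  uniformly in the cell. The remaining sum over the cells is an average of functions of
  \<open>x\<close> and \<open>T\<^sup>k x\<close>, and it is dominated by the indicator of a slightly enlarged recurrence set.
\<close>

lemma joint_return_mass:
  assumes R: "1-lipschitz_on UNIV R"
    and m: "0 \<le> m" "m \<le> 1" and small: "AE x in \<mu>. mass_radius \<mu> m x \<le> r0 / 2"
    and \<rho>: "0 < \<rho>" "\<rho> \<le> 1" "\<rho> \<le> r0 / 4" and kl: "0 < k" "0 < l" "real k \<le> \<sigma> * real l"
  shows "measure \<mu> (return_set R k 0 \<inter> return_set (mass_radius \<mu> m) (k + l) 0)
    \<le> measure \<mu> (return_set R k (9 * \<rho>)) * (m + A * (10 * \<rho>) powr \<beta>) + mixing_error \<rho> l"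
proof -
  let ?R' = "mass_radius \<mu> m" and ?S = "return_set R k 0 \<inter> return_set (mass_radius \<mu> m) (k + l) 0"
  let ?S' = "return_set R k (9 * \<rho>)" and ?B = "m + A * (10 * \<rho>) powr \<beta>"
  obtain F :: "'a set" and \<psi> where F: "finite F" "real (card F) \<le> K * \<rho> powr - D"
    and \<psi>: "\<And>y. \<psi> y \<in> test_functions \<rho>" "\<And>x. (\<Sum>y\<in>F. \<psi> y x) = 1"
    "\<And>x y. y \<in> F \<Longrightarrow> \<psi> y x \<noteq> 0 \<Longrightarrow> dist y x < 2 * \<rho>"
    using partition_at_scale[OF \<rho>(1,2)] by blast
  define f where "f y = (\<lambda>z. cutoff (R y + 4 * \<rho>) \<rho> (dist y z))" for y
  define h where "h y = (\<lambda>z. cutoff (?R' y + 4 * \<rho>) \<rho> (dist y z))" for y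
  have f: "f y \<in> test_functions \<rho>" and h: "h y \<in> test_functions \<rho>" for y
    unfolding f_def h_def by (rule cutoff_test_function[OF \<rho>(1)])+
  note R' = mass_radius_lipschitz[OF m(2)]
  have S: "?S \<in> sets \<mu>" "?S' \<in> sets \<mu>"
    using return_set_sets[OF R] return_set_sets[OF R'] by auto
  have int: "integrable \<mu> (\<lambda>x. \<psi> y x * f y ((T ^^ k) x) * h y ((T ^^ (k + l)) x))"
    "integrable \<mu> (\<lambda>x. \<psi> y x * f y ((T ^^ k) x))" for y
    by (rule integrable_test_products(3,2)[OF \<psi>(1) f h])+
  note nn = test_functionD(1)[OF \<psi>(1)] test_functionD(1)[OF f] test_functionD(1)[OF h]
  have "measure \<mu> ?S = (\<integral>x. indicator ?S x \<partial>\<mu>)" by (rule measure_eq_integral_indicator(1)[OF S(1)])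
  also have "\<dots> \<le> (\<integral>x. (\<Sum>y\<in>F. \<psi> y x * f y ((T ^^ k) x) * h y ((T ^^ (k + l)) x)) \<partial>\<mu>)"
  proof (intro integral_mono Bochner_Integration.integrable_sum int measure_eq_integral_indicator S)
    fix x
    show "indicator ?S x \<le> (\<Sum>y\<in>F. \<psi> y x * f y ((T ^^ k) x) * h y ((T ^^ (k + l)) x))"
    proof (cases "x \<in> ?S")
      case True
      have "\<psi> y x = \<psi> y x * f y ((T ^^ k) x) * h y ((T ^^ (k + l)) x)" if y: "y \<in> F" for y
      proof (cases "\<psi> y x = 0")
        case False
        then have d: "dist y x < 2 * \<rho>" using \<psi>(3)[OF y] by simp
        have near: "dist x ((T ^^ k) x) < R x" using True by (simp add: return_set_def)
        have "\<bar>R y - R x\<bar> \<le> dist y x"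
          using lipschitz_onD[OF R, of y x] by (simp add: dist_real_def)
        then have "dist y ((T ^^ k) x) \<le> R y + 4 * \<rho>"
          using d near dist_triangle[of y "(T ^^ k) x" x] by linarith
        moreover have "dist y ((T ^^ (k + l)) x) \<le> ?R' y + 4 * \<rho>"
        proof -
          have near': "dist x ((T ^^ (k + l)) x) < ?R' x" using True by (simp add: return_set_def)
          have "\<bar>?R' y - ?R' x\<bar> \<le> dist y x"
            using lipschitz_onD[OF R', of y x] by (simp add: dist_real_def)
          then show ?thesis using d near' dist_triangle[of y "(T ^^ (k + l)) x" x] by linarith
        qed
        ultimately show ?thesis by (simp add: f_def h_def cutoff_eq_1[OF \<rho>(1)])
      qed simp
      then have "(\<Sum>y\<in>F. \<psi> y x) = (\<Sum>y\<in>F. \<psi> y x * f y ((T ^^ k) x) * h y ((T ^^ (k + l)) x))"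
        by (rule sum.cong[OF refl])
      then show ?thesis using True \<psi>(2) by simp
    next
      case False
      then show ?thesis using nn by (auto intro!: sum_nonneg mult_nonneg_nonneg)
    qed
  qed
  also have "\<dots> = (\<Sum>y\<in>F. \<integral>x. \<psi> y x * f y ((T ^^ k) x) * h y ((T ^^ (k + l)) x) \<partial>\<mu>)"
    using int by (intro Bochner_Integration.integral_sum)
  also have "\<dots> \<le> (\<Sum>y\<in>F. (\<integral>x. \<psi> y x * f y ((T ^^ k) x) \<partial>\<mu>) * (\<integral>z. h y z \<partial>\<mu>)) + mixing_error \<rho> l"
    by (rule cells_mixing3[OF \<rho>(1,2) kl F(2) \<psi>(1) f h])
  also have "(\<Sum>y\<in>F. (\<integral>x. \<psi> y x * f y ((T ^^ k) x) \<partial>\<mu>) * (\<integral>z. h y z \<partial>\<mu>))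
      \<le> (\<Sum>y\<in>F. (\<integral>x. \<psi> y x * f y ((T ^^ k) x) \<partial>\<mu>) * ?B)"
  proof (rule sum_mono)
    fix y assume y: "y \<in> F"
    show "(\<integral>x. \<psi> y x * f y ((T ^^ k) x) \<partial>\<mu>) * (\<integral>z. h y z \<partial>\<mu>) \<le> (\<integral>x. \<psi> y x * f y ((T ^^ k) x) \<partial>\<mu>) * ?B"
    proof (cases "?R' y \<le> r0")
      case True
      have "(\<integral>z. h y z \<partial>\<mu>) \<le> measure \<mu> (ball y (?R' y + 4 * \<rho> + \<rho>))"
        unfolding h_def by (rule integral_cutoff_bounds[OF \<rho>(1)])
      also have "?R' y + 4 * \<rho> + \<rho> = ?R' y + 5 * \<rho>" by simp
      also have "measure \<mu> (ball y (?R' y + 5 * \<rho>)) \<le> ?B"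
        using ball_mass_upper[OF m(1) True, of "5 * \<rho>"] \<rho>(1) by simp
      finally show ?thesis
        using nn by (intro mult_left_mono) (auto intro: integral_nonneg_AE)
    next
      case False
      then have "(\<integral>x. \<psi> y x * f y ((T ^^ k) x) \<partial>\<mu>) = 0"
        using \<psi>(3)[OF y] by (intro cell_integral_eq_0[OF m(2) small \<rho>(3)]) auto
      then show ?thesis by simp
    qed
  qed
  also have "\<dots> = (\<Sum>y\<in>F. \<integral>x. \<psi> y x * f y ((T ^^ k) x) \<partial>\<mu>) * ?B"
    by (rule sum_distrib_right[symmetric])
  also have "(\<Sum>y\<in>F. \<integral>x. \<psi> y x * f y ((T ^^ k) x) \<partial>\<mu>)
      = (\<integral>x. (\<Sum>y\<in>F. \<psi> y x * f y ((T ^^ k) x)) \<partial>\<mu>)"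
    by (rule Bochner_Integration.integral_sum[symmetric]) (rule int(2))
  also have "(\<integral>x. (\<Sum>y\<in>F. \<psi> y x * f y ((T ^^ k) x)) \<partial>\<mu>) * ?B \<le> measure \<mu> ?S' * ?B"
  proof (rule mult_right_mono)
    have "(\<integral>x. (\<Sum>y\<in>F. \<psi> y x * f y ((T ^^ k) x)) \<partial>\<mu>) \<le> (\<integral>x. indicator ?S' x \<partial>\<mu>)"
    proof (intro integral_mono Bochner_Integration.integrable_sum int measure_eq_integral_indicator S)
      fix x
      show "(\<Sum>y\<in>F. \<psi> y x * f y ((T ^^ k) x)) \<le> indicator ?S' x"
      proof (cases "x \<in> ?S'")
        case True
        have "(\<Sum>y\<in>F. \<psi> y x * f y ((T ^^ k) x)) \<le> (\<Sum>y\<in>F. \<psi> y x)"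
          using nn test_functionD(2)[OF f] by (intro sum_mono mult_left_le) auto
        then show ?thesis using True \<psi>(2) by simp
      next
        case False
        have "\<psi> y x * f y ((T ^^ k) x) = 0" if y: "y \<in> F" for y
        proof (rule ccontr)
          assume nz: "\<psi> y x * f y ((T ^^ k) x) \<noteq> 0"
          then have 1: "dist y x < 2 * \<rho>" using \<psi>(3)[OF y] by simp
          have 2: "dist y ((T ^^ k) x) < R y + 5 * \<rho>"
            using nz cutoff_eq_0[OF \<rho>(1), of "R y + 4 * \<rho>" "dist y ((T ^^ k) x)"]
            by (force simp: f_def)
          have "dist x ((T ^^ k) x) < R x + 9 * \<rho>"
            using 1 2 dist_triangle[of x "(T ^^ k) x" y] lipschitz_onD[OF R, of y x]
            by (simp add: dist_real_def dist_commute)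
          then show False using False by (simp add: return_set_def)
        qed
        then have "(\<Sum>y\<in>F. \<psi> y x * f y ((T ^^ k) x)) = 0" by (intro sum.neutral) blast
        then show ?thesis by simp
      qed
    qed
    then show "(\<integral>x. (\<Sum>y\<in>F. \<psi> y x * f y ((T ^^ k) x)) \<partial>\<mu>) \<le> measure \<mu> ?S'"
      by (simp only: measure_eq_integral_indicator(1)[OF S(2)])
    show "0 \<le> ?B" using m pos by simp
  qed
  finally show ?thesis by simp
qed

section \<open>Choice of the scales and conclusion\<close>

text \<open>
  The factor \<open>\<rho> powr - (D + 3)\<close> in the decorrelation error costs half of the exponential decay if
  \<open>\<rho> = exp (- scale_rate * n)\<close>.
\<close>

definition scale_rate :: real where
  "scale_rate = \<tau> / (2 * (D + 3))"

definition scale :: "nat \<Rightarrow> real" where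
  "scale n = exp (- scale_rate * real n)"

definition decay_rate :: real where
  "decay_rate = min (\<tau> / 2) (scale_rate * \<beta>)"

text \<open>
  The number 28 is the largest increment of a radius, in units of the scale, to which Hoelder
  continuity is applied: \<open>2 * (5 + 9)\<close> in \<open>return_mass_upper\<close> with \<open>\<delta>\<close> equal to nine times the scale.
\<close>

definition decay_const :: real where
  "decay_const = A * 28 powr \<beta> + 27 * C * K"

lemma scale_rate_pos: "0 < scale_rate" and decay_rate_pos: "0 < decay_rate"
  using pos by (auto simp: scale_rate_def decay_rate_def)

lemma K_nonneg: "0 \<le> K"
  using covering[of 1] by (auto intro: order_trans[OF of_nat_0_le_iff])

lemma decay_const_pos: "0 < decay_const"
  using pos K_nonneg by (auto simp: decay_const_def intro!: add_pos_nonneg)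

lemma scale_pos: "0 < scale n" and scale_le_1: "scale n \<le> 1"
  using scale_rate_pos by (auto simp: scale_def)

lemma mixing_error_scale: "mixing_error (scale n) n \<le> 27 * C * K * exp (- decay_rate * real n)"
proof -
  have cancel: "e \<noteq> 0 \<Longrightarrow> \<tau> / (2 * e) * e = \<tau> / 2" for e by simp
  have "scale_rate * (D + 3) = \<tau> / 2"
    unfolding scale_rate_def by (rule cancel) (use pos in simp)
  moreover have "scale n powr - (D + 3) = exp (scale_rate * (D + 3) * real n)"
    by (simp add: scale_def exp_powr_real algebra_simps)
  ultimately have "scale n powr - (D + 3) = exp (\<tau> / 2 * real n)" by (simp only:)
  then have "scale n powr - (D + 3) * exp (- \<tau> * real n) = exp (- (\<tau> / 2) * real n)"
    by (simp add: exp_add[symmetric])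
  also have "\<dots> \<le> exp (- decay_rate * real n)"
  proof -
    have "decay_rate * real n \<le> \<tau> / 2 * real n"
      by (intro mult_right_mono) (simp_all add: decay_rate_def)
    then show ?thesis by simp
  qed
  finally show ?thesis
    unfolding mixing_error_def using pos K_nonneg
    by (simp only: mult.assoc) (intro mult_left_mono, auto)
qed

lemma scale_powr:
  assumes "0 \<le> t" "t \<le> 28 * scale n"
  shows "A * t powr \<beta> \<le> A * 28 powr \<beta> * exp (- decay_rate * real n)"
proof -
  have "t powr \<beta> \<le> (28 * scale n) powr \<beta>" using assms pos by (intro powr_mono2) auto
  also have "\<dots> = 28 powr \<beta> * exp (- (scale_rate * \<beta>) * real n)"
    using scale_pos by (simp add: powr_mult scale_def exp_powr_real algebra_simps)
  also have "\<dots> \<le> 28 powr \<beta> * exp (- decay_rate * real n)"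
    by (intro mult_left_mono) (auto simp: decay_rate_def mult_right_mono)
  finally show ?thesis using pos by simp
qed

text \<open>
  The upper bound of \<open>joint_return_mass\<close> is expressed by \<open>M k\<close> and \<open>M (k + l)\<close>; the lower bounds for the
  measures of the two recurrence sets turn it into their product.
\<close>

lemma decorrelation_at_small_scales:
  assumes M: "M k \<in> {0..1}" "M (k + l) \<in> {0..1}"
    and small: "AE x in \<mu>. mass_radius \<mu> (M k) x \<le> r0 / 2"
      "AE x in \<mu>. mass_radius \<mu> (M (k + l)) x \<le> r0 / 2"
    and scales: "scale k \<le> r0 / 4" and kl: "0 < k" "k \<le> l" "real k \<le> \<sigma> * real l"
  defines "B \<equiv> decay_const" and "\<eta> \<equiv> decay_rate"
    and "a \<equiv> measure \<mu> (recurrence_set \<mu> T M k)" and "b \<equiv> measure \<mu> (recurrence_set \<mu> T M (k + l))"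
  shows "measure \<mu> (recurrence_set \<mu> T M k \<inter> recurrence_set \<mu> T M (k + l))
    \<le> a * b + 2 * B * b * exp (- \<eta> * real k) + (2 * B * (1 + 2 * B) + B) * exp (- \<eta> * real l)"
proof -
  let ?x = "exp (- \<eta> * real k)" and ?y = "exp (- \<eta> * real l)"
  have rec: "recurrence_set \<mu> T M n = return_set (mass_radius \<mu> (M n)) n 0" for n
    by (simp add: recurrence_set_def return_set_def)
  have mono: "scale j \<le> scale i" "exp (- \<eta> * real j) \<le> exp (- \<eta> * real i)" if "i \<le> j" for i j
    using that scale_rate_pos decay_rate_pos by (simp_all add: scale_def \<eta>_def)
  have lo: "M n - B * exp (- \<eta> * real n) \<le> measure \<mu> (recurrence_set \<mu> T M n)"
    if "M n \<in> {0..1}" "AE x in \<mu>. mass_radius \<mu> (M n) x \<le> r0 / 2" "k \<le> n" for n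
  proof -
    have "M n - A * (10 * scale n) powr \<beta> - mixing_error (scale n) n
        \<le> measure \<mu> (recurrence_set \<mu> T M n)"
      unfolding rec using that scales kl mono(1)[OF that(3)] scale_pos scale_le_1
      by (intro return_mass_lower) auto
    moreover have "A * (10 * scale n) powr \<beta> \<le> A * 28 powr \<beta> * exp (- \<eta> * real n)"
      using scale_pos[of n] unfolding \<eta>_def by (intro scale_powr) auto
    ultimately show ?thesis using mixing_error_scale[of n]
      by (simp add: B_def decay_const_def \<eta>_def algebra_simps)
  qed
  have a: "M k \<le> a + B * ?x" using lo[OF M(1) small(1)] by (simp add: a_def)
  have "M (k + l) \<le> b + B * exp (- \<eta> * real (k + l))" using lo[OF M(2) small(2)] by (simp add: b_def)
  also have "\<dots> \<le> b + B * ?y"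
    using mono(2)[of l "k + l"] decay_const_pos by (auto simp: B_def intro!: mult_left_mono)
  finally have b: "M (k + l) \<le> b + B * ?y" .
  define U where "U = measure \<mu> (return_set (mass_radius \<mu> (M k)) k (9 * scale l))"
  have "U \<le> M k + A * (2 * (5 * scale k + 9 * scale l)) powr \<beta> + mixing_error (scale k) k"
    unfolding U_def using M small scales kl scale_pos[of k] scale_pos[of l] scale_le_1
    by (intro return_mass_upper) auto
  moreover have "A * (2 * (5 * scale k + 9 * scale l)) powr \<beta> \<le> A * 28 powr \<beta> * ?x"
    using scale_pos[of k] scale_pos[of l] mono(1)[OF kl(2)] unfolding \<eta>_def by (intro scale_powr) auto
  ultimately have "U \<le> M k + B * ?x" using mixing_error_scale[of k]
    by (simp add: B_def decay_const_def \<eta>_def algebra_simps)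
  with a have U: "U \<le> a + 2 * B * ?x" by simp
  have "measure \<mu> (recurrence_set \<mu> T M k \<inter> recurrence_set \<mu> T M (k + l))
      \<le> U * (M (k + l) + A * (10 * scale l) powr \<beta>) + mixing_error (scale l) l"
    unfolding rec U_def using M small scales kl mono(1)[OF kl(2)] scale_pos scale_le_1
    by (intro joint_return_mass mass_radius_lipschitz) auto
  also have "\<dots> \<le> (a + 2 * B * ?x) * (b + 2 * B * ?y) + B * ?y"
  proof -
    have p: "0 \<le> A * 28 powr \<beta>" "0 \<le> 27 * C * K" using pos K_nonneg by auto
    have "A * (10 * scale l) powr \<beta> \<le> A * 28 powr \<beta> * ?y"
      using scale_pos[of l] unfolding \<eta>_def by (intro scale_powr) auto
    also have "\<dots> \<le> B * ?y" using p by (simp add: B_def decay_const_def)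
    finally have "M (k + l) + A * (10 * scale l) powr \<beta> \<le> b + 2 * B * ?y" using b by simp
    moreover have "0 \<le> a + 2 * B * ?x" using decay_const_pos by (simp add: a_def B_def)
    moreover have "0 \<le> M (k + l) + A * (10 * scale l) powr \<beta>" using M pos by simp
    ultimately have "U * (M (k + l) + A * (10 * scale l) powr \<beta>) \<le> (a + 2 * B * ?x) * (b + 2 * B * ?y)"
      using U by (intro mult_mono)
    moreover have "27 * C * K * ?y \<le> B * ?y" using p by (simp add: B_def decay_const_def)
    then have "mixing_error (scale l) l \<le> B * ?y"
      by (rule order_trans[OF mixing_error_scale[of l, folded \<eta>_def]])
    ultimately show ?thesis by (rule add_mono)
  qed
  also have "\<dots> = a * b + 2 * B * b * ?x + 2 * B * (a + 2 * B * ?x) * ?y + B * ?y"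
    by (simp add: algebra_simps)
  also have "\<dots> \<le> a * b + 2 * B * b * ?x + 2 * B * (1 + 2 * B) * ?y + B * ?y"
  proof -
    have "a \<le> 1" by (simp add: a_def)
    moreover have "?x \<le> 1" using decay_rate_pos by (simp add: \<eta>_def)
    then have "2 * B * ?x \<le> 2 * B" using decay_const_pos by (simp add: B_def)
    ultimately have "a + 2 * B * ?x \<le> 1 + 2 * B" by (rule add_mono)
    then have "2 * B * (a + 2 * B * ?x) * ?y \<le> 2 * B * (1 + 2 * B) * ?y"
      by (rule mult_right_mono[OF mult_left_mono]) (use decay_const_pos in \<open>simp_all add: B_def\<close>)
    then show ?thesis by simp
  qed
  finally show ?thesis by (simp add: algebra_simps)
qed

lemma exp_decay_eventually_le:
  assumes "0 < c" "0 < e"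
  shows "\<forall>\<^sub>F n in sequentially. exp (- c * real n) \<le> e"
proof -
  obtain N :: nat where N: "1 / (c * e) < real N" using reals_Archimedean2 by blast
  have "exp (- c * real n) \<le> e" if "n \<ge> N" for n
  proof -
    have "1 / e < c * real N" using N assms by (simp add: field_simps)
    also have "\<dots> \<le> c * real n" using that assms by simp
    also have "\<dots> \<le> exp (c * real n)" using exp_ge_add_one_self[of "c * real n"] by linarith
    finally have "1 / e < exp (c * real n)" .
    then show ?thesis using assms by (simp add: exp_minus field_simps)
  qed
  then show ?thesis unfolding eventually_sequentially by blast
qed

text \<open>
  For \<open>k \<ge> N\<close> the constant \<open>Q\<close> in front of \<open>exp (- decay_rate * l)\<close> is absorbed by half of the decay, as
  \<open>l \<ge> k \<ge> N\<close>. For \<open>k < N\<close> the constant \<open>c\<close> is so large that the second term on the right alone is at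
  least the measure of the second recurrence set.
\<close>

theorem recurrence_sets_decorrelate:
  assumes M: "\<And>k. k \<ge> 1 \<Longrightarrow> M k \<in> {0..1}" "M \<longlonglongrightarrow> 0" and \<sigma>: "\<sigma> \<le> 1"
  shows "\<exists>C>0. \<exists>\<eta>>0. \<forall>k\<ge>1. \<forall>l\<ge>1. real k \<le> \<sigma> * real l \<longrightarrow>
    measure \<mu> (recurrence_set \<mu> T M k \<inter> recurrence_set \<mu> T M (k + l))
      \<le> measure \<mu> (recurrence_set \<mu> T M k) * measure \<mu> (recurrence_set \<mu> T M (k + l))
        + C * measure \<mu> (recurrence_set \<mu> T M (k + l)) * exp (- \<eta> * real k)
        + exp (- \<eta> * real l)"
proof -
  let ?B = decay_const and ?\<eta> = "decay_rate / 2"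
  let ?Q = "2 * ?B * (1 + 2 * ?B) + ?B"
  have B: "0 < ?B" by (rule decay_const_pos)
  then have Q: "0 < ?Q" by (auto intro!: add_pos_pos mult_pos_pos)
  have \<eta>: "0 < ?\<eta>" using decay_rate_pos by simp
  obtain m0 where m0: "0 < m0" "AE x in \<mu>. m0 \<le> measure \<mu> (ball x (r0 / 2))"
    using AE_ball_mass_bounded_below[of "r0 / 2"] pos by auto
  have small: "AE x in \<mu>. mass_radius \<mu> m x \<le> r0 / 2" if "m \<le> m0" for m
    using m0(2)
  proof eventually_elim
    case (elim x)
    show ?case by (rule mass_radius_le) (use elim that pos in auto)
  qed
  have "\<forall>\<^sub>F n in sequentially. M n < m0" using M(2) m0(1) by (rule order_tendstoD)
  moreover have "\<forall>\<^sub>F n in sequentially. scale n \<le> r0 / 4"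
    unfolding scale_def using scale_rate_pos pos by (intro exp_decay_eventually_le) auto
  moreover have "\<forall>\<^sub>F n in sequentially. exp (- ?\<eta> * real n) \<le> 1 / ?Q"
    using \<eta> Q by (intro exp_decay_eventually_le) auto
  ultimately have "\<forall>\<^sub>F n in sequentially. M n < m0 \<and> scale n \<le> r0 / 4 \<and> exp (- ?\<eta> * real n) \<le> 1 / ?Q"
    by eventually_elim simp
  then obtain N where N: "\<And>n. n \<ge> N \<Longrightarrow> M n < m0" "\<And>n. n \<ge> N \<Longrightarrow> scale n \<le> r0 / 4"
    "\<And>n. n \<ge> N \<Longrightarrow> exp (- ?\<eta> * real n) \<le> 1 / ?Q"
    unfolding eventually_sequentially by blast
  define c where "c = 2 * ?B + exp (?\<eta> * real N)"
  have c: "0 < c" "2 * ?B \<le> c" "exp (?\<eta> * real N) \<le> c"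
    using B by (auto simp: c_def add_pos_pos)
  have "measure \<mu> (recurrence_set \<mu> T M k \<inter> recurrence_set \<mu> T M (k + l))
      \<le> measure \<mu> (recurrence_set \<mu> T M k) * measure \<mu> (recurrence_set \<mu> T M (k + l))
        + c * measure \<mu> (recurrence_set \<mu> T M (k + l)) * exp (- ?\<eta> * real k)
        + exp (- ?\<eta> * real l)"
    if kl: "k \<ge> 1" "l \<ge> 1" "real k \<le> \<sigma> * real l" for k l
  proof -
    let ?J = "measure \<mu> (recurrence_set \<mu> T M k \<inter> recurrence_set \<mu> T M (k + l))"
    let ?a = "measure \<mu> (recurrence_set \<mu> T M k)" and ?b = "measure \<mu> (recurrence_set \<mu> T M (k + l))"
    have "\<sigma> * real l \<le> real l" using mult_right_mono[OF \<sigma>, of "real l"] by simp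
    then have "k \<le> l" using kl by linarith
    show ?thesis
    proof (cases "k < N")
      case True
      have "recurrence_set \<mu> T M (k + l) = return_set (mass_radius \<mu> (M (k + l))) (k + l) 0"
        by (simp add: recurrence_set_def return_set_def)
      moreover have "M (k + l) \<le> 1" using M(1)[of "k + l"] kl by simp
      ultimately have "recurrence_set \<mu> T M (k + l) \<in> sets \<mu>"
        by (metis return_set_sets mass_radius_lipschitz)
      then have "?J \<le> ?b" by (intro finite_measure_mono) auto
      also have "\<dots> \<le> c * ?b * exp (- ?\<eta> * real k)"
      proof -
        have "exp (?\<eta> * real k) \<le> exp (?\<eta> * real N)" using True \<eta> by simp
        then have "exp (?\<eta> * real k) \<le> c" using c(3) by linarith
        then have "1 \<le> c * exp (- ?\<eta> * real k)" by (simp add: exp_minus field_simps)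
        from mult_right_mono[OF this, of ?b] show ?thesis by (simp add: mult_ac)
      qed
      finally show ?thesis by (smt (verit) measure_nonneg mult_nonneg_nonneg exp_ge_zero)
    next
      case False
      then have "?J \<le> ?a * ?b + 2 * ?B * ?b * exp (- decay_rate * real k) + ?Q * exp (- decay_rate * real l)"
        using kl \<open>k \<le> l\<close> M(1) N(1)[of k] N(1)[of "k + l"] N(2)[of k]
        by (intro decorrelation_at_small_scales small) auto
      also have "2 * ?B * ?b * exp (- decay_rate * real k) \<le> c * ?b * exp (- ?\<eta> * real k)"
        using c B \<eta> by (intro mult_mono mult_right_mono) auto
      also have "?Q * exp (- decay_rate * real l) \<le> exp (- ?\<eta> * real l)"
      proof -
        have "?Q * exp (- ?\<eta> * real l) \<le> 1"
          using N(3)[of l] False \<open>k \<le> l\<close> Q by (simp add: field_simps)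
        from mult_right_mono[OF this, of "exp (- ?\<eta> * real l)"]
        have "?Q * (exp (- ?\<eta> * real l) * exp (- ?\<eta> * real l)) \<le> exp (- ?\<eta> * real l)"
          by (simp only: mult.assoc mult_1 exp_ge_zero)
        moreover have "exp (- ?\<eta> * real l) * exp (- ?\<eta> * real l) = exp (- decay_rate * real l)"
          by (simp add: exp_add[symmetric])
        ultimately show ?thesis by (simp only:)
      qed
      finally show ?thesis by simp
    qed
  qed
  then show ?thesis using c(1) \<eta> by blast
qed

end

theorem lemma3:
  fixes atlas :: "('a::metric_space, 'e::euclidean_space) chart set"
    and g :: "('a, 'e) chart \<Rightarrow> 'a \<Rightarrow> 'e \<Rightarrow> 'e \<Rightarrow> real"
    and \<mu> :: "'a measure"
    and T :: "'a \<Rightarrow> 'a"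
    and \<sigma> :: real
    and M :: "nat \<Rightarrow> real"
  assumes "compact_riemannian_manifold atlas g"
    and "metric_mps \<mu> T"
    and "threefold_decorrelation \<mu> T \<sigma>"
    and "frostman \<mu>"
    and "thin_annuli \<mu>"
    and "\<And>k. k \<ge> 1 \<Longrightarrow> M k \<in> {0..1}"
    and "M \<longlonglongrightarrow> 0"
  shows "\<exists>C>0. \<exists>\<eta>>0. \<forall>k\<ge>1. \<forall>l\<ge>1. real k \<le> \<sigma> * real l \<longrightarrow>
    measure \<mu> (recurrence_set \<mu> T M k \<inter> recurrence_set \<mu> T M (k + l))
      \<le> measure \<mu> (recurrence_set \<mu> T M k) * measure \<mu> (recurrence_set \<mu> T M (k + l))
        + C * measure \<mu> (recurrence_set \<mu> T M (k + l)) * exp (- \<eta> * real k)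
        + exp (- \<eta> * real l)"
proof -
  interpret compact_riemannian_manifold atlas g by fact
  interpret metric_mps \<mu> T by fact
  obtain D K where D: "0 \<le> D" and K: "\<And>\<rho>. 0 < \<rho> \<Longrightarrow> \<rho> \<le> 1 \<Longrightarrow>
      \<exists>F. finite F \<and> real (card F) \<le> K * \<rho> powr - D \<and> (UNIV :: 'a set) \<subseteq> (\<Union>x\<in>F. ball x \<rho>)"
    using polynomially_coverable_UNIV unfolding polynomially_coverable_def by metis
  obtain A \<beta> r where r: "0 < A" "0 < \<beta>" "0 < r"
    "\<And>x a b. a \<le> b \<Longrightarrow> a \<le> r \<Longrightarrow>
       measure \<mu> (ball x b) \<le> measure \<mu> (ball x a) + A * (b - a) powr \<beta>"
    using ball_mass_modulus[OF prob_space_axioms sets_borel assms(4,5)] by blast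
  have \<sigma>: "\<sigma> \<le> 1" using assms(3) unfolding threefold_decorrelation_def by blast
  obtain C \<tau> where C: "0 < C" "0 < \<tau>" and mixing: "\<forall>\<phi>1 \<phi>2 \<phi>3.
        nonneg_lipschitz \<phi>1 \<longrightarrow> nonneg_lipschitz \<phi>2 \<longrightarrow> nonneg_lipschitz \<phi>3 \<longrightarrow>
        (\<forall>k>0. \<forall>l>0.
           \<bar>(\<integral>x. \<phi>1 x * \<phi>2 ((T ^^ k) x) * \<phi>3 ((T ^^ (k + l)) x) \<partial>\<mu>)
             - (\<integral>x. \<phi>1 x \<partial>\<mu>) * (\<integral>x. \<phi>2 x \<partial>\<mu>) * (\<integral>x. \<phi>3 x \<partial>\<mu>)\<bar>
           \<le> C * lip_norm \<phi>1 * lip_norm \<phi>2 * lip_norm \<phi>3 * exp (- \<tau> * real (min k l))) \<and>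
        (\<forall>k>0. \<forall>l>0. real k \<le> \<sigma> * real l \<longrightarrow>
           \<bar>(\<integral>x. \<phi>1 x * \<phi>2 ((T ^^ k) x) * \<phi>3 ((T ^^ (k + l)) x) \<partial>\<mu>)
             - (\<integral>x. \<phi>1 x * \<phi>2 ((T ^^ k) x) \<partial>\<mu>) * (\<integral>x. \<phi>3 x \<partial>\<mu>)\<bar>
           \<le> C * lip_norm \<phi>1 * lip_norm \<phi>2 * lip_norm \<phi>3 * exp (- \<tau> * real l))"
    using assms(3) unfolding threefold_decorrelation_def by (elim exE conjE) (rule that)
  note mixing = mixing[THEN spec, THEN spec, THEN spec, THEN mp, THEN mp, THEN mp]
  \<comment> \<open>Twofold decorrelation is the threefold one with equal gaps and a constant third function.\<close>
  have one: "nonneg_lipschitz (\<lambda>x::'a. 1)"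
    unfolding nonneg_lipschitz_def by (auto intro!: exI[of _ 0] lipschitz_onI)
  have two: "\<bar>(\<integral>x. \<phi>1 x * \<phi>2 ((T ^^ n) x) \<partial>\<mu>) - (\<integral>x. \<phi>1 x \<partial>\<mu>) * (\<integral>x. \<phi>2 x \<partial>\<mu>)\<bar>
        \<le> C * lip_norm \<phi>1 * lip_norm \<phi>2 * exp (- \<tau> * real n)"
    if "nonneg_lipschitz \<phi>1" "nonneg_lipschitz \<phi>2" "0 < n" for \<phi>1 \<phi>2 n
  proof -
    have "(\<integral>x. 1 \<partial>\<mu>) = (1::real)" using prob_space by simp
    with mixing[OF that(1,2) one, THEN conjunct1, THEN spec, THEN mp, THEN spec, THEN mp, OF that(3,3)]
    show ?thesis by (simp only: lip_norm_const_1 mult_1_right min.idem)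
  qed
  note three = mixing[THEN conjunct2, THEN spec, THEN mp, THEN spec, THEN mp, THEN mp]
  interpret mixing_system \<mu> T K D A \<beta> r C \<tau> \<sigma>
    by unfold_locales (fact D r C K two three)+
  show ?thesis by (rule recurrence_sets_decorrelate[OF assms(6,7) \<sigma>])
qed

end
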